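(* Suppose $\Omega\subset\mathbb{P}(\mathbb{R}^d)$ is a quasi-homogeneous properly convex domain and $m\ge\mathrm{r}_{\rm PES}(\Omega)+1$. There exists $\delta_0'>0$ such that for any $m+1$ points $x_0,\dots,x_m\in\Omega$ and any $\delta\ge\delta_0'$, $$C_{\frac{\delta}{2}}(x_0,\dots,x_m)\neq\emptyset.$$ In particular, one may choose $\delta_0'=2\delta_0$, where $\delta_0=\delta_0(\Omega)>0$ is a constant such that for every $n\ge\mathrm{r}_{\rm PES}(\Omega)+1$ every compact $n$-simplex in $\Omega$ is $\delta_0$-slim (such a constant exists).
   Context: A properly convex domain is a nonempty open set $\Omega\subset\mathbb{P}(\mathbb{R}^d)$ whose closure $\overline{\Omega}$ lies in some affine chart, in which $\Omega$ is a bounded convex set; its dimension is assumed to be at least one. $\partial\Omega=\overline\Omega\setminus\Omega$, $\mathrm{Aut}(\Omega)=\{g\in \mathrm{PGL}_d(\mathbb{R}): g\Omega=\Omega\}$, and $\Omega$ is quasi-homogeneous if there is a compact $K\subset\Omega$ with $\mathrm{Aut}(\Omega)\cdot K=\Omega$. Hilbert metric: for distinct $x,y\in\Omega$ let $x_\infty,y_\infty\in\partial\Omega$ be the endpoints of the intersection of the projective line through $x,y$ with $\overline\Omega$, ordered $x_\infty,x,y,y_\infty$; then $d_\Omega(x,y)=\frac12\log\frac{|y-x_\infty||x-y_\infty|}{|x-x_\infty||y-y_\infty|}$ (and $d_\Omega(x,x)=0$). For nonempty $C\subset\Omega$ and $\delta>0$, $\mathcal{N}_\delta(C)=\{x\in\Omega: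 d_\Omega(x,C)<\delta\}$, and $\mathcal{N}_0(C)=C$. $\mathrm{CH}_\Omega(X)$ is the convex hull of $X$ in $\overline\Omega$, i.e. the intersection of all convex subsets of $\overline\Omega$ (convex in the affine chart) containing $X$. For $k\ge1$, a $k$-simplex is $S=\mathrm{CH}_\Omega(v_0,\dots,v_k)$ with an ordered tuple of vertices $v_0,\dots,v_k\in\overline\Omega$ (no general position is required); it is non-degenerate if $\dim\mathbb{P}(\mathrm{Span}\{v_0,\dots,v_k\})=k$. Its facets are $F^i(S)=\mathrm{CH}_\Omega(v_0,\dots,\widehat{v_i},\dots,v_k)$. It is a compact $k$-simplex in $\Omega$ if all $v_i\in\Omega$. A compact $k$-simplex $S$ is $\delta$-slim if for all $0\le i\le k$, $F^i(S)\subset\bigcup_{j\ne i}\mathcal{N}_\delta(F^j(S))$. The $\delta$-centroid of $x_0,\dots,x_k\in\Omega$ is $C_\delta(x_0,\dots,x_k)=\bigcap_{i=0}^k\mathcal{N}_\delta(\mathrm{CH}_\Omega(x_0,\dots,\widehat{x_i},\dots,x_k))$. A $k$-dimensional PES in $\Omega$, $k\ge1$, is a non-degenerate $k$-simplex $S$ with vertices in $\partial\Omega$ such that $S\cap\Omega\ne\emptyset$ and $F^i(S)\subset\partial\Omega$ for all $i$. The projective simplex rank is $\mathrm{r}_{\rm PES}(\Omega)=\sup\{\dim S: S\text{ is a PES in }\Omega\}$. *)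

theory Defs
  imports "HOL-Analysis.Analysis" "HOL-Library.Extended_Nat"
begin

section \<open>Real projective space\<close>

text \<open>The points of P(R^d), with d = CARD('n), are the lines through the origin of R^d.\<close>

typedef ('n::finite) proj_space = "{L :: (real ^ 'n) set. subspace L \<and> dim L = 1}"
  morphisms line_of Abs_proj_space
proof -
  obtain b :: "real ^ 'n" where "b \<in> Basis" by (meson nonempty_Basis ex_in_conv)
  then have "b \<noteq> 0" by auto
  then have "dim (span {b}) = 1" by (simp add: dim_singleton)
  then have "span {b} \<in> {L. subspace L \<and> dim L = 1}" by (simp add: subspace_span)
  then show ?thesis by blast
qed

definition proj :: "real ^ 'n \<Rightarrow> ('n::finite) proj_space" where
  "proj v = Abs_proj_space (span {v})"

lemma line_of_proj: "v \<noteq> 0 \<Longrightarrow> line_of (proj v) = span {v}"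
  unfolding proj_def by (rule Abs_proj_space_inverse) (simp add: subspace_span dim_singleton)

text \<open>The topology is the quotient topology from the nonzero vectors.\<close>

instantiation proj_space :: (finite) topological_space
begin

definition open_proj_space :: "'a proj_space set \<Rightarrow> bool" where
  "open_proj_space U \<longleftrightarrow> open {v. v \<noteq> 0 \<and> proj v \<in> U}"

instance
proof
  show "open (UNIV :: 'a proj_space set)"
    by (simp add: open_proj_space_def open_Collect_neq)
next
  fix S T :: "'a proj_space set"
  assume "open S" "open T"
  then have "open ({v. v \<noteq> 0 \<and> proj v \<in> S} \<inter> {v. v \<noteq> 0 \<and> proj v \<in> T})"
    by (simp add: open_proj_space_def open_Int)
  moreover have "{v. v \<noteq> 0 \<and> proj v \<in> S} \<inter> {v. v \<noteq> 0 \<and> proj v \<in> T}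
      = {v. v \<noteq> 0 \<and> proj v \<in> S \<inter> T}" by blast
  ultimately show "open (S \<inter> T)" by (simp add: open_proj_space_def)
next
  fix K :: "'a proj_space set set"
  assume "\<forall>S\<in>K. open S"
  then have "open (\<Union>S\<in>K. {v. v \<noteq> 0 \<and> proj v \<in> S})"
    by (intro open_UN) (simp add: open_proj_space_def)
  moreover have "(\<Union>S\<in>K. {v. v \<noteq> 0 \<and> proj v \<in> S}) = {v. v \<noteq> 0 \<and> proj v \<in> \<Union>K}" by blast
  ultimately show "open (\<Union>K)" by (simp add: open_proj_space_def)
qed

end

definition proj_line :: "('n::finite) proj_space \<Rightarrow> 'n proj_space \<Rightarrow> 'n proj_space set" where
  "proj_line x y = {z. line_of z \<subseteq> span (line_of x \<union> line_of y)}"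

text \<open>PGL_d(R) acts faithfully on P(R^d), and is identified with its image under this action.\<close>

definition proj_map :: "real ^ 'n ^ 'n \<Rightarrow> ('n::finite) proj_space \<Rightarrow> 'n proj_space" where
  "proj_map A x = Abs_proj_space ((\<lambda>v. A *v v) ` line_of x)"

definition PGL :: "(('n::finite) proj_space \<Rightarrow> 'n proj_space) set" where
  "PGL = {proj_map A | A. invertible A}"

section \<open>Affine charts and properly convex domains\<close>

text \<open>A nonzero covector a determines the affine chart consisting of the lines on which a does not
  vanish; it is identified with the affine hyperplane of the vectors v with a v = 1.\<close>

definition affine_chart :: "real ^ 'n \<Rightarrow> ('n::finite) proj_space set" where
  "affine_chart a = {x. \<exists>v \<in> line_of x. a \<bullet> v \<noteq> 0}"

definition coord :: "real ^ 'n \<Rightarrow> ('n::finite) proj_space \<Rightarrow> real ^ 'n" where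
  "coord a x = (THE v. v \<in> line_of x \<and> a \<bullet> v = 1)"

definition convex_chart :: "('n::finite) proj_space set \<Rightarrow> real ^ 'n \<Rightarrow> bool" where
  "convex_chart \<Omega> a \<longleftrightarrow> a \<noteq> 0 \<and> closure \<Omega> \<subseteq> affine_chart a
     \<and> convex (coord a ` \<Omega>) \<and> bounded (coord a ` \<Omega>)"

text \<open>The dimension of a nonempty open subset of P(R^d) is d - 1, so the standing assumption that
  domains have dimension at least one says that d is at least 2.\<close>

definition properly_convex_domain :: "('n::finite) proj_space set \<Rightarrow> bool" where
  "properly_convex_domain \<Omega> \<longleftrightarrow>
     CARD('n) \<ge> 2 \<and> open \<Omega> \<and> \<Omega> \<noteq> {} \<and> (\<exists>a. convex_chart \<Omega> a)"

definition boundary :: "('n::finite) proj_space set \<Rightarrow> 'n proj_space set" where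
  "boundary \<Omega> = closure \<Omega> - \<Omega>"

definition Aut :: "('n::finite) proj_space set \<Rightarrow> ('n proj_space \<Rightarrow> 'n proj_space) set" where
  "Aut \<Omega> = {g \<in> PGL. g ` \<Omega> = \<Omega>}"

definition quasi_homogeneous :: "('n::finite) proj_space set \<Rightarrow> bool" where
  "quasi_homogeneous \<Omega> \<longleftrightarrow> (\<exists>K. compact K \<and> K \<subseteq> \<Omega> \<and> (\<Union>g \<in> Aut \<Omega>. g ` K) = \<Omega>)"

section \<open>The Hilbert metric\<close>

text \<open>The endpoints p and q, in the order p, x, y, q, for distinct points x and y of the domain.\<close>

definition endpoints :: "real ^ 'n \<Rightarrow> ('n::finite) proj_space set \<Rightarrow> 'n proj_space \<Rightarrow>
    'n proj_space \<Rightarrow> 'n proj_space \<times> 'n proj_space \<Rightarrow> bool" where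
  "endpoints a \<Omega> x y = (\<lambda>(p, q). p \<in> boundary \<Omega> \<and> q \<in> boundary \<Omega>
     \<and> coord a ` (proj_line x y \<inter> closure \<Omega>) = closed_segment (coord a p) (coord a q)
     \<and> coord a x \<in> open_segment (coord a p) (coord a y)
     \<and> coord a y \<in> open_segment (coord a x) (coord a q))"

text \<open>Cross-ratios are projective invariants, so the value does not depend on the chosen chart.\<close>

definition hilbert_dist :: "('n::finite) proj_space set \<Rightarrow> 'n proj_space \<Rightarrow> 'n proj_space \<Rightarrow> real" where
  "hilbert_dist \<Omega> x y =
     (if x = y then 0
      else let a = (SOME a. convex_chart \<Omega> a);
               (p, q) = (THE e. endpoints a \<Omega> x y e)
           in 1 / 2 * ln ((dist (coord a y) (coord a p) * dist (coord a x) (coord a q))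
                        / (dist (coord a x) (coord a p) * dist (coord a y) (coord a q))))"

definition hilbert_nbhd :: "('n::finite) proj_space set \<Rightarrow> real \<Rightarrow> 'n proj_space set \<Rightarrow> 'n proj_space set" where
  "hilbert_nbhd \<Omega> \<delta> C =
     (if \<delta> = 0 then C else {x \<in> \<Omega>. (INF c \<in> C. hilbert_dist \<Omega> x c) < \<delta>})"

section \<open>Convex hulls and simplices\<close>

text \<open>Transition maps between charts containing the closure of the domain preserve segments in this
  closure, so convexity of its subsets does not depend on the chart.\<close>

definition CH :: "('n::finite) proj_space set \<Rightarrow> 'n proj_space set \<Rightarrow> 'n proj_space set" where
  "CH \<Omega> X = \<Inter> {C. C \<subseteq> closure \<Omega> \<and> (\<exists>a. convex_chart \<Omega> a \<and> convex (coord a ` C)) \<and> X \<subseteq> C}"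

text \<open>The ordered tuple of vertices of a k-simplex is given by the values at 0, ..., k of a function
  on the natural numbers.\<close>

definition proj_simplex :: "('n::finite) proj_space set \<Rightarrow> nat \<Rightarrow> (nat \<Rightarrow> 'n proj_space) \<Rightarrow> 'n proj_space set" where
  "proj_simplex \<Omega> k v = CH \<Omega> (v ` {..k})"

definition facet :: "('n::finite) proj_space set \<Rightarrow> nat \<Rightarrow> (nat \<Rightarrow> 'n proj_space) \<Rightarrow> nat \<Rightarrow> 'n proj_space set" where
  "facet \<Omega> k v i = CH \<Omega> (v ` ({..k} - {i}))"

text \<open>The projective space of a linear subspace W has dimension dim W - 1.\<close>

definition nondegenerate :: "nat \<Rightarrow> (nat \<Rightarrow> ('n::finite) proj_space) \<Rightarrow> bool" where
  "nondegenerate k v \<longleftrightarrow> dim (span (\<Union>i\<le>k. line_of (v i))) = k + 1"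

definition compact_simplex :: "('n::finite) proj_space set \<Rightarrow> nat \<Rightarrow> (nat \<Rightarrow> 'n proj_space) \<Rightarrow> bool" where
  "compact_simplex \<Omega> k v \<longleftrightarrow> k \<ge> 1 \<and> (\<forall>i\<le>k. v i \<in> \<Omega>)"

definition slim :: "('n::finite) proj_space set \<Rightarrow> real \<Rightarrow> nat \<Rightarrow> (nat \<Rightarrow> 'n proj_space) \<Rightarrow> bool" where
  "slim \<Omega> \<delta> k v \<longleftrightarrow>
     (\<forall>i\<le>k. facet \<Omega> k v i \<subseteq> (\<Union>j \<in> {..k} - {i}. hilbert_nbhd \<Omega> \<delta> (facet \<Omega> k v j)))"

definition centroid :: "('n::finite) proj_space set \<Rightarrow> real \<Rightarrow> nat \<Rightarrow> (nat \<Rightarrow> 'n proj_space) \<Rightarrow> 'n proj_space set" where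
  "centroid \<Omega> \<delta> k x = (\<Inter>i\<le>k. hilbert_nbhd \<Omega> \<delta> (CH \<Omega> (x ` ({..k} - {i}))))"

section \<open>Properly embedded simplices\<close>

definition PES :: "('n::finite) proj_space set \<Rightarrow> nat \<Rightarrow> (nat \<Rightarrow> 'n proj_space) \<Rightarrow> bool" where
  "PES \<Omega> k v \<longleftrightarrow> k \<ge> 1 \<and> nondegenerate k v \<and> (\<forall>i\<le>k. v i \<in> boundary \<Omega>)
     \<and> proj_simplex \<Omega> k v \<inter> \<Omega> \<noteq> {} \<and> (\<forall>i\<le>k. facet \<Omega> k v i \<subseteq> boundary \<Omega>)"

definition r_PES :: "('n::finite) proj_space set \<Rightarrow> enat" where
  "r_PES \<Omega> = Sup {enat k | k. \<exists>v. PES \<Omega> k v}"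

definition slimness_constant :: "('n::finite) proj_space set \<Rightarrow> real \<Rightarrow> bool" where
  "slimness_constant \<Omega> \<delta>0 \<longleftrightarrow> \<delta>0 > 0 \<and>
     (\<forall>n v. enat n \<ge> r_PES \<Omega> + 1 \<and> compact_simplex \<Omega> n v \<longrightarrow> slim \<Omega> \<delta>0 n v)"

end

theory Submission
  imports Defs
begin

text \<open>Lift the domain to an open convex cone in the space of vectors.  There the simplex spanned by
  points is the set of nonnegative combinations of their lifts, and the Hilbert metric has Birkhoff's
  form: the distance of x and y is below \<delta> iff l y - x and m x - y lie in the closed cone for some
  positive l, m with l m < exp (2 \<delta>).

  Slimness: affinely dependent tuples are slim for trivial reasons, which bounds the dimension of the
  others.  For a fixed dimension n, a sequence of points on facets that move away from the
  other facets can be brought back to a compact set by automorphisms.  In the limit, all facets but one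
  lie in the boundary; the vertex opposite to this one is then extreme in the span of the simplex, so a second
  limit along a segment tending to this vertex yields a properly embedded simplex of dimension n.

  Centroid: slimness says that one facet is covered by the neighbourhoods of the others.  By
  Brouwer's fixed point theorem these neighbourhoods have a common point in that facet.\<close>

section \<open>The cone over a properly convex domain\<close>

text \<open>Failure of slimness yields points that escape from every facet except the one they lie
  on. The first limit therefore says nothing against that facet, which keeps a point
  \<open>p\<close> of the open cone; the second limit, along
  \<open>w i + (1 / k) *\<^sub>R p\<close>, is there to push this last facet into the boundary.
  Independence of the limit vertices then comes for free: a dependence would move an interior point
  of the simplex onto some facet.

  The passage from slimness to centroids loses nothing in the constant. Nearness is a strict
  inequality, so the neighbourhoods are open, and the fixed point argument gives a common point for
  the same \<open>\<delta>0\<close>; the factor 2 in the statement merely answers the division of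
  \<delta> by 2 there.

  Charts enter the definitions in two ways. \<open>hilbert_dist\<close> uses one chosen chart, so
  this very chart is fixed and invariance of cross-ratios is avoided. \<open>CH\<close> admits every
  chart, so signs of different covectors on the cone have to be compared.\<close>

lemma proj_surj: obtains v where "v \<noteq> 0" "x = proj v"
proof -
  have L: "subspace (line_of x)" "dim (line_of x) = 1"
    using line_of[of x] by auto
  obtain B where B: "B \<subseteq> line_of x" "independent B" "line_of x \<subseteq> span B" "card B = 1"
    using basis_exists[of "line_of x"] L by metis
  then obtain v where v: "B = {v}" by (meson card_1_singletonE)
  have "v \<noteq> 0" using B(2) v dependent_zero by blast
  moreover have "span {v} = line_of x"
    using B v L(1) by (metis span_minimal subset_antisym)
  then have "x = proj v" unfolding proj_def by (metis line_of_inverse)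
  ultimately show ?thesis using that by blast
qed

lemma proj_eq_iff:
  assumes "v \<noteq> 0" "w \<noteq> 0"
  shows "proj v = proj w \<longleftrightarrow> (\<exists>c. c \<noteq> 0 \<and> w = c *\<^sub>R v)"
proof
  assume "proj v = proj w"
  then have "span {v} = span {w}" using assms by (metis line_of_proj)
  then have "w \<in> span {v}" by (simp add: span_base)
  then show "\<exists>c. c \<noteq> 0 \<and> w = c *\<^sub>R v" using assms by (auto simp: span_singleton)
next
  assume "\<exists>c. c \<noteq> 0 \<and> w = c *\<^sub>R v"
  then obtain c where "c \<noteq> 0" "w = c *\<^sub>R v" by blast
  then have "span {w} = span {v}" using span_image_scale[of "{v}" "\<lambda>_. c"] by simp
  then show "proj v = proj w" by (simp add: proj_def)
qed

lemma proj_scaleR: "c \<noteq> 0 \<Longrightarrow> proj (c *\<^sub>R v) = proj v"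
  using proj_eq_iff[of v "c *\<^sub>R v"] by (cases "v = 0") auto

lemma proj_in_affine_chart: "v \<noteq> 0 \<Longrightarrow> proj v \<in> affine_chart a \<longleftrightarrow> a \<bullet> v \<noteq> 0"
  by (auto simp: affine_chart_def line_of_proj span_singleton)

lemma coord_proj:
  assumes "a \<bullet> v \<noteq> 0"
  shows "coord a (proj v) = v /\<^sub>R (a \<bullet> v)"
  unfolding coord_def
proof (rule the_equality)
  have "v \<noteq> 0" using assms by auto
  then show "v /\<^sub>R (a \<bullet> v) \<in> line_of (proj v) \<and> a \<bullet> (v /\<^sub>R (a \<bullet> v)) = 1"
    using assms by (simp add: line_of_proj span_base span_scale)
  fix w assume "w \<in> line_of (proj v) \<and> a \<bullet> w = 1"
  then obtain c where "w = c *\<^sub>R v" "c * (a \<bullet> v) = 1"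
    using \<open>v \<noteq> 0\<close> by (auto simp: line_of_proj span_singleton)
  then show "w = v /\<^sub>R (a \<bullet> v)" by (metis assms inverse_unique mult.commute)
qed

lemma proj_coord:
  assumes "x \<in> affine_chart a" shows "proj (coord a x) = x"
proof -
  obtain v where v: "v \<noteq> 0" "x = proj v" by (rule proj_surj)
  then have "a \<bullet> v \<noteq> 0" using assms by (simp add: proj_in_affine_chart)
  then show ?thesis using v(2) by (simp add: coord_proj proj_scaleR)
qed

lemma proj_map_proj:
  assumes "A *v v \<noteq> 0"
  shows "proj_map A (proj v) = proj (A *v v)"
proof -
  have "v \<noteq> 0" using assms by auto
  have "(\<lambda>u. A *v u) ` span {v} = span {A *v v}"
    using linear_span_image[OF matrix_vector_mul_linear, of A "{v}"] by simp
  then show ?thesis unfolding proj_map_def line_of_proj[OF \<open>v \<noteq> 0\<close>] by (simp add: proj_def)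
qed

text \<open>The preimage of \<open>S\<close> is invariant under nonzero scalings, and so is its
  closure. The complement of this closure is thus saturated, and its image is open in the quotient
  topology.\<close>

lemma proj_in_closure_iff:
  assumes "v \<noteq> 0"
  shows "proj v \<in> closure S \<longleftrightarrow> v \<in> closure {u. u \<noteq> 0 \<and> proj u \<in> S}" (is "_ \<longleftrightarrow> v \<in> closure ?P")
proof
  assume v: "v \<in> closure ?P"
  show "proj v \<in> closure S"
  proof (rule ccontr)
    let ?U = "- closure S"
    assume nv: "proj v \<notin> closure S"
    have "open {u. u \<noteq> 0 \<and> proj u \<in> ?U}"
      using open_Compl[OF closed_closure, of S] by (simp only: open_proj_space_def)
    moreover have "{u. u \<noteq> 0 \<and> proj u \<in> ?U} \<inter> ?P = {}" using closure_subset[of S] by blast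
    ultimately have "{u. u \<noteq> 0 \<and> proj u \<in> ?U} \<inter> closure ?P = {}"
      by (simp only: open_Int_closure_eq_empty)
    moreover have "v \<in> {u. u \<noteq> 0 \<and> proj u \<in> ?U}" using nv assms by simp
    ultimately show False using v by (metis (no_types, lifting) IntI empty_iff)
  qed
next
  assume v: "proj v \<in> closure S"
  show "v \<in> closure ?P"
  proof (rule ccontr)
    assume nv: "v \<notin> closure ?P"
    define U where "U = proj ` (- closure ?P - {0})"
    have hom: "c *\<^sub>R u \<in> closure ?P" if "u \<in> closure ?P" "c \<noteq> 0" for c u
    proof -
      have "(*\<^sub>R) c ` ?P \<subseteq> ?P" using that(2) by (auto simp: proj_scaleR)
      then have "closure ((*\<^sub>R) c ` ?P) \<subseteq> closure ?P" by (rule closure_mono)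
      then show ?thesis using that(1) unfolding closure_scaleR[symmetric] by blast
    qed
    have "{u. u \<noteq> 0 \<and> proj u \<in> U} = - closure ?P - {0}"
    proof (intro equalityI subsetI)
      fix u assume "u \<in> {u. u \<noteq> 0 \<and> proj u \<in> U}"
      then obtain w where w: "u \<noteq> 0" "w \<noteq> 0" "w \<notin> closure ?P" "proj u = proj w"
        by (auto simp: U_def)
      then obtain c where "c \<noteq> 0" "w = c *\<^sub>R u" using proj_eq_iff by blast
      then show "u \<in> - closure ?P - {0}" using w hom by auto
    qed (auto simp: U_def)
    then have "open U"
      using open_Diff[of "- closure ?P" "{0}"] by (simp add: open_proj_space_def open_Compl)
    moreover have "proj v \<in> U" using nv assms by (auto simp: U_def)
    ultimately have "U \<inter> S \<noteq> {}"
      using v open_Int_closure_eq_empty[of U S] by blast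
    then obtain w where "w \<noteq> 0" "w \<notin> closure ?P" "proj w \<in> S" by (auto simp: U_def)
    then show False using closure_subset[of ?P] by auto
  qed
qed

locale cone_over_domain =
  fixes \<Omega> :: "('n::finite) proj_space set" and a :: "real ^ 'n"
  assumes open_domain: "open \<Omega>" and nonempty: "\<Omega> \<noteq> {}" and chart: "convex_chart \<Omega> a"
begin

text \<open>The lines in \<Omega> fill two opposite cones. The sign of \<open>a\<close> selects one
  of them, which is what makes sums and positive combinations meaningful.\<close>

definition cone :: "(real ^ 'n) set" where
  "cone = {v. a \<bullet> v > 0 \<and> proj v \<in> \<Omega>}"

abbreviation "ccone \<equiv> closure cone"

lemma open_cone: "open cone"
proof -
  have "cone = {v. v \<noteq> 0 \<and> proj v \<in> \<Omega>} \<inter> {v. a \<bullet> v > 0}" by (auto simp: cone_def)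
  then show ?thesis
    using open_domain by (simp add: open_proj_space_def open_halfspace_gt open_Int)
qed

lemma cone_pos: "v \<in> cone \<Longrightarrow> a \<bullet> v > 0"
  by (simp add: cone_def)

lemma proj_cone: "v \<in> cone \<Longrightarrow> proj v \<in> \<Omega>"
  by (simp add: cone_def)

lemma cone_scale: "v \<in> cone \<Longrightarrow> c > 0 \<Longrightarrow> c *\<^sub>R v \<in> cone"
  by (simp add: cone_def proj_scaleR)

lemma domain_chart: "v \<noteq> 0 \<Longrightarrow> proj v \<in> closure \<Omega> \<Longrightarrow> a \<bullet> v \<noteq> 0"
  using chart proj_in_affine_chart unfolding convex_chart_def by blast

lemma domain_obtain:
  assumes "x \<in> \<Omega>" obtains v where "v \<in> cone" "a \<bullet> v = 1" "x = proj v" "coord a x = v"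
proof -
  obtain w where w: "w \<noteq> 0" "x = proj w" by (rule proj_surj)
  then have nz: "a \<bullet> w \<noteq> 0" using assms domain_chart closure_subset by blast
  define v where "v = w /\<^sub>R (a \<bullet> w)"
  have "a \<bullet> v = 1" "proj v = x" using nz w by (auto simp: v_def proj_scaleR)
  moreover from this have "v \<in> cone" using assms by (simp add: cone_def)
  moreover have "coord a x = v" using w nz by (simp add: v_def coord_proj)
  ultimately show ?thesis using that by blast
qed

lemma coord_image_domain: "coord a ` \<Omega> = {v \<in> cone. a \<bullet> v = 1}"
proof (intro equalityI subsetI)
  fix v assume "v \<in> coord a ` \<Omega>"
  then obtain x where x: "x \<in> \<Omega>" "v = coord a x" by blast
  show "v \<in> {v \<in> cone. a \<bullet> v = 1}" by (rule domain_obtain[OF x(1)]) (simp add: x(2))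
next
  fix v assume "v \<in> {v \<in> cone. a \<bullet> v = 1}"
  then have "coord a (proj v) = v" "proj v \<in> \<Omega>" by (auto simp: coord_proj cone_def)
  then show "v \<in> coord a ` \<Omega>" by (metis image_eqI)
qed

lemma cone_normalize: "v \<in> cone \<Longrightarrow> v /\<^sub>R (a \<bullet> v) \<in> coord a ` \<Omega>"
  unfolding coord_image_domain using cone_pos[of v] by (simp add: cone_scale)

text \<open>The normalisation of \<open>v + w\<close> is the convex combination of the normalised
  vectors with weights proportional to \<open>a \<bullet> v\<close> and
  \<open>a \<bullet> w\<close>.\<close>

lemma cone_add:
  assumes "v \<in> cone" "w \<in> cone" shows "v + w \<in> cone"
proof -
  let ?s = "a \<bullet> v + a \<bullet> w"
  have pos: "a \<bullet> v > 0" "a \<bullet> w > 0" using assms cone_pos by auto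
  have "(a \<bullet> v / ?s) *\<^sub>R (v /\<^sub>R (a \<bullet> v)) + (a \<bullet> w / ?s) *\<^sub>R (w /\<^sub>R (a \<bullet> w)) \<in> coord a ` \<Omega>"
    using chart assms[THEN cone_normalize] pos unfolding convex_chart_def
    by (intro convexD) (auto simp: add_divide_distrib[symmetric])
  also have "(a \<bullet> v / ?s) *\<^sub>R (v /\<^sub>R (a \<bullet> v)) + (a \<bullet> w / ?s) *\<^sub>R (w /\<^sub>R (a \<bullet> w)) = (v + w) /\<^sub>R ?s"
    using pos by (simp add: scaleR_add_right divide_inverse_commute mult.assoc)
  finally have "(v + w) /\<^sub>R ?s \<in> cone" by (simp add: coord_image_domain)
  from cone_scale[OF this, of ?s] pos show ?thesis by simp
qed

lemma ccone_scale: 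
  assumes "v \<in> ccone" "c \<ge> 0" shows "c *\<^sub>R v \<in> ccone"
proof (cases "c = 0")
  case False
  have "(*\<^sub>R) c ` cone \<subseteq> cone" using False assms(2) cone_scale by auto
  from closure_mono[OF this] show ?thesis
    using assms(1) unfolding closure_scaleR[symmetric] by blast
next
  case True
  obtain u where u: "u \<in> cone" using nonempty by (metis domain_obtain ex_in_conv)
  have "(\<lambda>n. inverse (real (Suc n)) *\<^sub>R u) \<longlonglongrightarrow> 0 *\<^sub>R u"
    by (intro tendsto_intros LIMSEQ_inverse_real_of_nat)
  moreover have "\<forall>n. inverse (real (Suc n)) *\<^sub>R u \<in> cone" using u cone_scale by simp
  ultimately show ?thesis unfolding True closure_sequential
    by (intro exI[of _ "\<lambda>n. inverse (real (Suc n)) *\<^sub>R u"]) simp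
qed

lemma ccone_add:
  assumes "v \<in> ccone" "w \<in> ccone" shows "v + w \<in> ccone"
proof -
  have "v + w \<in> closure cone + closure cone" using assms by (rule set_plus_intro)
  also have "\<dots> \<subseteq> closure (cone + cone)" by (rule closure_sum)
  also have "\<dots> \<subseteq> ccone" by (rule closure_mono) (auto simp: set_plus_def cone_add)
  finally show ?thesis .
qed

text \<open>The error made in replacing \<open>v\<close> by a nearby \<open>u\<close> of the cone is
  absorbed by \<open>w\<close>, which has a ball of room. This is the usual way below to reach the
  open cone from its closure.\<close>

lemma ccone_cone_add:
  assumes "v \<in> ccone" "w \<in> cone" shows "v + w \<in> cone"
proof -
  obtain e where e: "e > 0" "ball w e \<subseteq> cone" using assms(2) open_cone openE by blast
  obtain u where u: "u \<in> cone" "dist u v < e" using assms(1) e(1) closure_approachable by blast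
  have "w + (v - u) \<in> cone" using e(2) u(2) by (auto simp: dist_norm norm_minus_commute)
  from cone_add[OF this u(1)] show ?thesis by (simp add: algebra_simps)
qed

text \<open>Boundedness of the domain in its chart, made homogeneous. It makes the closed cone
  pointed and its slice \<open>a \<bullet> v = 1\<close> compact.\<close>

lemma ccone_norm_bound: "\<exists>B>0. \<forall>v\<in>ccone. norm v \<le> B * (a \<bullet> v)"
proof -
  obtain B where B: "B > 0" "\<And>v. v \<in> coord a ` \<Omega> \<Longrightarrow> norm v \<le> B"
    using chart unfolding convex_chart_def by (metis bounded_pos)
  have "norm v \<le> B * (a \<bullet> v)" if "v \<in> cone" for v
    using B(2)[OF cone_normalize[OF that]] cone_pos[OF that] by (simp add: field_simps)
  then have "cone \<subseteq> {v. norm v \<le> B * (a \<bullet> v)}" by blast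
  moreover have "closed {v. norm v \<le> B * (a \<bullet> v)}"
    by (intro closed_Collect_le continuous_intros)
  ultimately have "ccone \<subseteq> {v. norm v \<le> B * (a \<bullet> v)}" by (rule closure_minimal)
  then show ?thesis using B(1) by blast
qed

lemma ccone_pos:
  assumes "v \<in> ccone" "v \<noteq> 0" shows "a \<bullet> v > 0"
proof -
  obtain B where B: "B > 0" "norm v \<le> B * (a \<bullet> v)" using ccone_norm_bound assms(1) by blast
  moreover have "norm v > 0" using assms(2) by simp
  ultimately have "B * (a \<bullet> v) > 0" by linarith
  then show ?thesis using B(1) by (simp add: zero_less_mult_iff)
qed

lemma ccone_nonneg: "v \<in> ccone \<Longrightarrow> a \<bullet> v \<ge> 0"
  using ccone_pos[of v] by (cases "v = 0") auto

lemma cone_ccone: "v \<in> cone \<Longrightarrow> v \<in> ccone"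
  using closure_subset by blast

text \<open>On the open half-space where \<open>a\<close> is positive, the cone is the whole
  preimage of \<Omega>; intersecting with an open set is harmless for closures.\<close>

lemma proj_in_closure_domain_iff:
  assumes "a \<bullet> v > 0"
  shows "proj v \<in> closure \<Omega> \<longleftrightarrow> v \<in> ccone"
proof -
  let ?P = "{u. u \<noteq> 0 \<and> proj u \<in> \<Omega>}" and ?H = "{u. a \<bullet> u > 0}"
  have "?H \<inter> ?P = cone" by (auto simp: cone_def)
  then have "?H \<inter> closure ?P \<subseteq> ccone"
    using open_Int_closure_subset[OF open_halfspace_gt[of 0 a], of ?P] by simp
  moreover have "ccone \<subseteq> closure ?P"
    by (rule closure_mono) (auto simp: cone_def)
  ultimately have "v \<in> closure ?P \<longleftrightarrow> v \<in> ccone" using assms by blast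
  then show ?thesis using assms by (subst proj_in_closure_iff) auto
qed

lemma closure_obtain:
  assumes "x \<in> closure \<Omega>" obtains v where "v \<in> ccone" "a \<bullet> v = 1" "x = proj v" "coord a x = v"
proof -
  obtain w where w: "w \<noteq> 0" "x = proj w" by (rule proj_surj)
  then have nz: "a \<bullet> w \<noteq> 0" using assms domain_chart by blast
  define v where "v = w /\<^sub>R (a \<bullet> w)"
  have "a \<bullet> v = 1" "proj v = x" using nz w by (auto simp: v_def proj_scaleR)
  moreover from this have "v \<in> ccone" using assms proj_in_closure_domain_iff[of v] by simp
  moreover have "coord a x = v" using w nz by (simp add: v_def coord_proj)
  ultimately show ?thesis using that by blast
qed

lemma proj_ccone: "v \<in> ccone \<Longrightarrow> v \<noteq> 0 \<Longrightarrow> proj v \<in> closure \<Omega>"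
  using proj_in_closure_domain_iff[OF ccone_pos] by simp

lemma proj_in_domain_iff:
  assumes "v \<in> ccone" "v \<noteq> 0" shows "proj v \<in> \<Omega> \<longleftrightarrow> v \<in> cone"
  unfolding cone_def[THEN eqset_imp_iff] using ccone_pos[OF assms] by simp

end

section \<open>Convex hulls as nonnegative combinations\<close>

text \<open>The coefficients are not normalised, so positive rescaling of single vectors
  \<open>w j\<close> leaves the set unchanged, as suits projective points. One positive coefficient
  is demanded to keep out the origin when the \<open>w j\<close> are nonzero vectors of a pointed
  cone.\<close>

definition pos_hull :: "('i \<Rightarrow> 'a::real_vector) \<Rightarrow> 'i set \<Rightarrow> 'a set" where
  "pos_hull w J = {(\<Sum>j\<in>J. t j *\<^sub>R w j) | t. (\<forall>j\<in>J. 0 \<le> t j) \<and> (\<exists>j\<in>J. 0 < t j)}"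

lemma pos_hullI:
  "\<forall>j\<in>J. 0 \<le> t j \<Longrightarrow> \<exists>j\<in>J. 0 < t j \<Longrightarrow> (\<Sum>j\<in>J. t j *\<^sub>R w j) \<in> pos_hull w J"
  unfolding pos_hull_def by blast

lemma pos_hullI_nonzero:
  assumes "\<forall>j\<in>J. 0 \<le> t j" "(\<Sum>j\<in>J. t j *\<^sub>R w j) \<noteq> 0"
  shows "(\<Sum>j\<in>J. t j *\<^sub>R w j) \<in> pos_hull w J"
proof (rule pos_hullI[OF assms(1)], rule ccontr)
  assume "\<not> (\<exists>j\<in>J. 0 < t j)"
  then have "\<forall>j\<in>J. t j = 0" using assms(1) by (meson antisym_conv2 not_less)
  then have "(\<Sum>j\<in>J. t j *\<^sub>R w j) = 0" by (intro sum.neutral) simp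
  then show False using assms(2) by simp
qed

lemma pos_hull_add:
  assumes "x \<in> pos_hull w J" "y \<in> pos_hull w J" shows "x + y \<in> pos_hull w J"
proof -
  obtain t s where t: "x = (\<Sum>j\<in>J. t j *\<^sub>R w j)" "\<forall>j\<in>J. 0 \<le> t j" "\<exists>j\<in>J. 0 < t j"
    and s: "y = (\<Sum>j\<in>J. s j *\<^sub>R w j)" "\<forall>j\<in>J. 0 \<le> s j"
    using assms unfolding pos_hull_def by blast
  have "x + y = (\<Sum>j\<in>J. (t j + s j) *\<^sub>R w j)"
    by (simp add: t(1) s(1) scaleR_add_left sum.distrib)
  moreover have "\<dots> \<in> pos_hull w J"
    using t s by (intro pos_hullI) (auto intro: add_pos_nonneg)
  ultimately show ?thesis by simp
qed

lemma pos_hull_scale: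
  assumes "x \<in> pos_hull w J" "c > 0" shows "c *\<^sub>R x \<in> pos_hull w J"
proof -
  obtain t where t: "x = (\<Sum>j\<in>J. t j *\<^sub>R w j)" "\<forall>j\<in>J. 0 \<le> t j" "\<exists>j\<in>J. 0 < t j"
    using assms unfolding pos_hull_def by blast
  have "c *\<^sub>R x = (\<Sum>j\<in>J. (c * t j) *\<^sub>R w j)"
    by (simp add: t(1) scaleR_sum_right)
  moreover have "\<dots> \<in> pos_hull w J"
    using t assms(2) by (intro pos_hullI) (auto intro: mult_pos_pos)
  ultimately show ?thesis by simp
qed

lemma convex_pos_hull: "convex (pos_hull w J)"
  unfolding convex_def
proof (intro ballI allI impI)
  fix x y and u v :: real
  assume xy: "x \<in> pos_hull w J" "y \<in> pos_hull w J" and uv: "0 \<le> u" "0 \<le> v" "u + v = 1"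
  consider "u = 0" | "v = 0" | "u > 0" "v > 0" using uv by linarith
  then show "u *\<^sub>R x + v *\<^sub>R y \<in> pos_hull w J"
    by cases (use xy uv in \<open>auto intro: pos_hull_add pos_hull_scale\<close>)
qed

lemma pos_hull_base:
  assumes "finite J" "j \<in> J" shows "w j \<in> pos_hull w J"
proof -
  have "(\<Sum>i\<in>J. (if i = j then 1 else 0) *\<^sub>R w i) \<in> pos_hull w J"
    using assms by (intro pos_hullI) auto
  also have "(\<Sum>i\<in>J. (if i = j then 1 else 0) *\<^sub>R w i) = (\<Sum>i\<in>J. if i = j then w i else 0)"
    by (rule sum.cong) auto
  also have "\<dots> = w j" using assms by simp
  finally show ?thesis .
qed

lemma pos_hull_mono:
  assumes "finite J" "I \<subseteq> J" shows "pos_hull w I \<subseteq> pos_hull w J"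
proof
  fix x assume "x \<in> pos_hull w I"
  then obtain t where t: "x = (\<Sum>j\<in>I. t j *\<^sub>R w j)" "\<forall>j\<in>I. 0 \<le> t j" "\<exists>j\<in>I. 0 < t j"
    unfolding pos_hull_def by blast
  have "x = (\<Sum>j\<in>J. (if j \<in> I then t j else 0) *\<^sub>R w j)"
    unfolding t(1) by (rule sum.mono_neutral_cong_left) (use assms in auto)
  also have "\<dots> \<in> pos_hull w J" using t assms(2) by (intro pos_hullI) auto
  finally show "x \<in> pos_hull w J" .
qed

context cone_over_domain
begin

lemma sum_in_ccone:
  assumes "\<forall>j\<in>J. w j \<in> ccone" "\<forall>j\<in>J. 0 \<le> t j"
  shows "(\<Sum>j\<in>J. t j *\<^sub>R w j) \<in> ccone"
proof (cases "finite J")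
  case True
  then show ?thesis using assms
  proof (induction J)
    case empty
    obtain u where "u \<in> cone" using nonempty by (metis domain_obtain ex_in_conv)
    then show ?case using ccone_scale[OF cone_ccone, of u 0] by simp
  next
    case (insert j J)
    then show ?case by (auto intro!: ccone_add ccone_scale)
  qed
next
  case False
  obtain u where "u \<in> cone" using nonempty by (metis domain_obtain ex_in_conv)
  then show ?thesis using ccone_scale[OF cone_ccone, of u 0] False by simp
qed

lemma pos_hull_ccone:
  assumes "finite J" "\<forall>j\<in>J. w j \<in> ccone \<and> w j \<noteq> 0" "y \<in> pos_hull w J"
  shows "y \<in> ccone" "a \<bullet> y > 0" "y \<noteq> 0"
proof -
  obtain t where t: "y = (\<Sum>j\<in>J. t j *\<^sub>R w j)" "\<forall>j\<in>J. 0 \<le> t j" "\<exists>j\<in>J. 0 < t j"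
    using assms(3) unfolding pos_hull_def by blast
  show "y \<in> ccone" unfolding t(1) using assms(2) t(2) by (intro sum_in_ccone) auto
  have pos: "a \<bullet> w j > 0" if "j \<in> J" for j using assms(2) that ccone_pos by blast
  obtain i where i: "i \<in> J" "0 < t i" using t(3) by blast
  have "(\<Sum>j\<in>J. t j * (a \<bullet> w j)) > 0"
    using assms(1) t(2) i pos by (intro sum_pos2[of J i]) (auto simp: less_imp_le)
  then show "a \<bullet> y > 0" by (simp add: t(1) inner_sum_right)
  then show "y \<noteq> 0" by auto
qed

lemma pos_hull_cone:
  assumes "finite J" "\<forall>j\<in>J. w j \<in> cone" "y \<in> pos_hull w J"
  shows "y \<in> cone"
proof -
  obtain t where t: "y = (\<Sum>j\<in>J. t j *\<^sub>R w j)" "\<forall>j\<in>J. 0 \<le> t j" "\<exists>j\<in>J. 0 < t j"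
    using assms(3) unfolding pos_hull_def by blast
  obtain i where i: "i \<in> J" "0 < t i" using t(3) by blast
  have "y = (\<Sum>j\<in>J - {i}. t j *\<^sub>R w j) + t i *\<^sub>R w i"
    unfolding t(1) using assms(1) i(1) by (subst sum.remove[of J i]) auto
  moreover have "(\<Sum>j\<in>J - {i}. t j *\<^sub>R w j) \<in> ccone"
    using assms(2) t(2) cone_ccone by (intro sum_in_ccone) auto
  ultimately show ?thesis using ccone_cone_add cone_scale assms(2) i by metis
qed

text \<open>The covector of a chart has no zero in \<open>ccone\<close> besides the origin. Opposite
  signs at \<open>x\<close> and \<open>y\<close> would produce the zero \<open>?u\<close>, a nonzero
  vector because \<open>a\<close> is positive on it.\<close>

lemma chart_sign:
  assumes b: "convex_chart \<Omega> b" and v: "v \<in> ccone" "v \<noteq> 0" and w: "w \<in> ccone" "w \<noteq> 0"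
  shows "(b \<bullet> v) * (b \<bullet> w) > 0"
proof -
  have nz: "b \<bullet> u \<noteq> 0" if "u \<in> ccone" "u \<noteq> 0" for u
    using b proj_ccone[OF that] proj_in_affine_chart[OF that(2)] unfolding convex_chart_def by blast
  have *: False if h: "b \<bullet> x > 0" "b \<bullet> y < 0" "x \<in> ccone" "x \<noteq> 0" "y \<in> ccone" "y \<noteq> 0" for x y
  proof -
    let ?u = "(- (b \<bullet> y)) *\<^sub>R x + (b \<bullet> x) *\<^sub>R y"
    have "?u \<in> ccone" using h by (intro ccone_add ccone_scale) auto
    moreover have "a \<bullet> x > 0" "a \<bullet> y > 0" using ccone_pos h by blast+
    then have "a \<bullet> ?u > 0" using h
      by (simp only: inner_add_right inner_scaleR_right) (intro add_pos_pos mult_pos_pos; simp)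
    then have "?u \<noteq> 0" by auto
    ultimately have "b \<bullet> ?u \<noteq> 0" by (rule nz)
    then show False by (simp add: inner_diff_right inner_add_right)
  qed
  show ?thesis
    using *[of v w] *[of w v] v w nz[OF v] nz[OF w]
    by (metis linorder_neqE_linordered_idom mult_neg_neg mult_pos_pos)
qed

text \<open>The projected hull is one of the sets that \<open>CH\<close> intersects, by its
  convexity in the chart \<open>a\<close>. Conversely, a competing set is convex in a chart
  \<open>b\<close> of its own, and the combination has to be rewritten there.\<close>

lemma CH_proj:
  assumes fin: "finite J" and w: "\<forall>j\<in>J. w j \<in> ccone \<and> w j \<noteq> 0"
  shows "CH \<Omega> ((\<lambda>j. proj (w j)) ` J) = proj ` pos_hull w J"
proof (rule subset_antisym)
  let ?H = "pos_hull w J"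
  have H: "y \<in> ccone" "a \<bullet> y > 0" "y \<noteq> 0" if "y \<in> ?H" for y
    using pos_hull_ccone[OF fin w that] by auto
  have "coord a ` proj ` ?H = ?H \<inter> {y. a \<bullet> y = 1}"
  proof (intro equalityI subsetI)
    fix x assume "x \<in> coord a ` proj ` ?H"
    then obtain y where y: "y \<in> ?H" "x = coord a (proj y)" by blast
    then have "x = y /\<^sub>R (a \<bullet> y)" using H(2)[OF y(1)] by (simp add: coord_proj)
    then show "x \<in> ?H \<inter> {y. a \<bullet> y = 1}" using H(2)[OF y(1)] y(1) by (auto intro: pos_hull_scale)
  next
    fix x assume x: "x \<in> ?H \<inter> {y. a \<bullet> y = 1}"
    then have "coord a (proj x) = x" by (simp add: coord_proj)
    then show "x \<in> coord a ` proj ` ?H" using x by (metis IntD1 image_eqI)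
  qed
  then have "convex (coord a ` proj ` ?H)"
    by (simp add: convex_Int convex_pos_hull convex_hyperplane)
  moreover have "proj ` ?H \<subseteq> closure \<Omega>" using H proj_ccone by blast
  moreover have "(\<lambda>j. proj (w j)) ` J \<subseteq> proj ` ?H" using pos_hull_base[OF fin] by blast
  ultimately show "CH \<Omega> ((\<lambda>j. proj (w j)) ` J) \<subseteq> proj ` ?H"
    unfolding CH_def using chart by (intro Inter_lower) blast
next
  show "proj ` pos_hull w J \<subseteq> CH \<Omega> ((\<lambda>j. proj (w j)) ` J)"
    unfolding CH_def
  proof (intro Inter_greatest subsetI)
    fix C x assume "C \<in> {C. C \<subseteq> closure \<Omega> \<and> (\<exists>a. convex_chart \<Omega> a \<and> convex (coord a ` C))
      \<and> (\<lambda>j. proj (w j)) ` J \<subseteq> C}" and x: "x \<in> proj ` pos_hull w J"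
    then obtain b where C: "C \<subseteq> closure \<Omega>" "convex_chart \<Omega> b" "convex (coord b ` C)"
      "\<And>j. j \<in> J \<Longrightarrow> proj (w j) \<in> C" by blast
    obtain y where y: "x = proj y" "y \<in> pos_hull w J" using x by blast
    obtain t where t: "y = (\<Sum>j\<in>J. t j *\<^sub>R w j)" "\<forall>j\<in>J. 0 \<le> t j"
      using y(2) unfolding pos_hull_def by blast
    have yc: "y \<in> ccone" "y \<noteq> 0" using pos_hull_ccone[OF fin w y(2)] by auto
    have sgn: "(b \<bullet> y) * (b \<bullet> w j) > 0" if "j \<in> J" for j
      using chart_sign[OF C(2) yc] w that by blast
    have by0: "b \<bullet> y \<noteq> 0" using chart_sign[OF C(2) yc yc] by auto
    \<comment> \<open>Normalising by \<open>b\<close> divides \<open>w j\<close> by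
      \<open>b \<bullet> w j\<close> and the sum \<open>y\<close> by \<open>b \<bullet> y\<close>.
      The weights are nonnegative because all these numbers have the same sign.\<close>
    let ?c = "\<lambda>j. t j * (b \<bullet> w j) / (b \<bullet> y)"
    have "(\<Sum>j\<in>J. ?c j *\<^sub>R coord b (proj (w j))) \<in> coord b ` C"
    proof (rule convex_sum[OF fin C(3)])
      have "(\<Sum>j\<in>J. ?c j) = (\<Sum>j\<in>J. t j * (b \<bullet> w j)) / (b \<bullet> y)"
        by (rule sum_divide_distrib[symmetric])
      also have "(\<Sum>j\<in>J. t j * (b \<bullet> w j)) = b \<bullet> y" by (simp add: t(1) inner_sum_right)
      finally show "(\<Sum>j\<in>J. ?c j) = 1" using by0 by simp
      show "0 \<le> ?c j" if "j \<in> J" for j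
      proof -
        have "(b \<bullet> w j) / (b \<bullet> y) \<ge> 0"
          using sgn[OF that] by (auto simp: zero_le_divide_iff zero_less_mult_iff)
        then have "t j * ((b \<bullet> w j) / (b \<bullet> y)) \<ge> 0" using t(2) that by (intro mult_nonneg_nonneg) auto
        then show ?thesis by simp
      qed
      show "coord b (proj (w j)) \<in> coord b ` C" if "j \<in> J" for j using C(4) that by blast
    qed
    also have "(\<Sum>j\<in>J. ?c j *\<^sub>R coord b (proj (w j))) = (\<Sum>j\<in>J. (t j / (b \<bullet> y)) *\<^sub>R w j)"
    proof (rule sum.cong[OF refl])
      fix j assume "j \<in> J"
      then have "b \<bullet> w j \<noteq> 0" using sgn by force
      then show "?c j *\<^sub>R coord b (proj (w j)) = (t j / (b \<bullet> y)) *\<^sub>R w j"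
        by (simp add: coord_proj)
    qed
    also have "\<dots> = y /\<^sub>R (b \<bullet> y)"
      by (simp add: t(1) scaleR_sum_right divide_inverse_commute)
    also have "\<dots> = coord b x" using by0 by (simp add: y(1) coord_proj)
    finally obtain z where z: "z \<in> C" "coord b z = coord b x" by (metis imageE)
    have "C \<subseteq> affine_chart b" using C(1,2) unfolding convex_chart_def by blast
    moreover have "x \<in> affine_chart b" using y(1) yc(2) by0 by (simp add: proj_in_affine_chart)
    ultimately have "z = x" using z by (metis proj_coord subsetD)
    then show "x \<in> C" using z(1) by simp
  qed
qed

end

section \<open>The Hilbert metric in the cone\<close>

lemma closed_segment_affine_line:
  fixes u d :: "'a::real_vector"
  shows "closed_segment (u + s *\<^sub>R d) (u + t *\<^sub>R d) = (\<lambda>r. u + r *\<^sub>R d) ` closed_segment s t"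
proof -
  have "linear (\<lambda>r. r *\<^sub>R d)" by (simp add: linear_iff scaleR_add_left)
  from closed_segment_linear_image[OF this, of s t] show ?thesis
    by (simp add: closed_segment_translation image_image)
qed

lemma open_segment_affine_line:
  fixes u d :: "'a::real_vector"
  assumes "d \<noteq> 0"
  shows "open_segment (u + s *\<^sub>R d) (u + t *\<^sub>R d) = (\<lambda>r. u + r *\<^sub>R d) ` open_segment s t"
proof -
  have "linear (\<lambda>r. r *\<^sub>R d)" "inj (\<lambda>r. r *\<^sub>R d)"
    using assms by (auto simp: linear_iff scaleR_add_left inj_on_def)
  from open_segment_linear_image[OF this, of s t] show ?thesis
    by (simp add: open_segment_translation image_image)
qed

text \<open>The chart is the one picked by \<open>SOME\<close> in \<open>hilbert_dist\<close>, so
  that the definition can be unfolded without comparing charts.\<close>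

locale hilbert_domain = cone_over_domain \<Omega> a
  for \<Omega> :: "('n::finite) proj_space set" and a :: "real ^ 'n" +
  assumes chart_choice: "a = (SOME b. convex_chart \<Omega> b)"
begin

text \<open>The parameters in the closed cone form a compact convex set. Those in the open cone form
  an open subset, which lies in the interior of the interval and hence avoids its endpoints.\<close>

lemma chord_interval:
  assumes u: "u \<in> cone" "a \<bullet> u = 1" and w: "w \<in> cone" "a \<bullet> w = 1" and "u \<noteq> w"
  obtains s0 s1 where "s0 < 0" "1 < s1" "{s. u + s *\<^sub>R (w - u) \<in> ccone} = {s0..s1}"
    "u + s0 *\<^sub>R (w - u) \<notin> cone" "u + s1 *\<^sub>R (w - u) \<notin> cone"
proof -
  let ?l = "\<lambda>s. u + s *\<^sub>R (w - u)"
  let ?T = "{s. ?l s \<in> ccone}" and ?O = "{s. ?l s \<in> cone}"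
  have cont: "continuous_on UNIV ?l" by (intro continuous_intros)
  have T: "?T = ?l -` ccone" "?O = ?l -` cone" by auto
  have closedT: "closed ?T" unfolding T using continuous_closed_vimage[of ccone ?l] cont
    by (simp add: continuous_on_eq_continuous_at)
  have openO: "open ?O" unfolding T using open_vimage[OF open_cone cont] .
  have al: "a \<bullet> ?l s = 1" for s using u w by (simp add: inner_add_right inner_diff_right)
  obtain B where B: "B > 0" "\<forall>v\<in>ccone. norm v \<le> B * (a \<bullet> v)" using ccone_norm_bound by blast
  have d: "norm (w - u) > 0" using assms(5) by simp
  have "\<bar>s\<bar> \<le> (B + norm u) / norm (w - u)" if "s \<in> ?T" for s
  proof -
    have "norm (?l s) \<le> B" using B(2) that al[of s] by force
    moreover have "norm (s *\<^sub>R (w - u)) \<le> norm (?l s) + norm u"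
      by (metis add_diff_cancel_left' norm_triangle_ineq4)
    ultimately have "\<bar>s\<bar> * norm (w - u) \<le> B + norm u" unfolding norm_scaleR by linarith
    then show ?thesis using d by (simp add: pos_le_divide_eq)
  qed
  then have "bounded ?T" by (intro boundedI) auto
  with closedT have "compact ?T" by (simp add: compact_eq_bounded_closed)
  moreover have "convex ?T"
    unfolding convex_def
  proof (intro ballI allI impI)
    fix x y p q :: real assume h: "x \<in> ?T" "y \<in> ?T" "0 \<le> p" "0 \<le> q" "p + q = 1"
    have "p *\<^sub>R ?l x + q *\<^sub>R ?l y \<in> ccone"
      using h by (intro ccone_add[OF ccone_scale ccone_scale]) auto
    also have "p *\<^sub>R ?l x + q *\<^sub>R ?l y = (p + q) *\<^sub>R u + (p * x + q * y) *\<^sub>R (w - u)"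
      by (simp only: scaleR_add_right scaleR_add_left scaleR_scaleR) (simp add: algebra_simps)
    finally show "p *\<^sub>R x + q *\<^sub>R y \<in> ?T" using h(5) by simp
  qed
  ultimately obtain s0 s1 where S: "?T = {s0..s1}"
    using connected_compact_interval_1 convex_connected by metis
  have "?O \<subseteq> {s0..s1}" using S cone_ccone by blast
  then have O: "?O \<subseteq> {s0<..<s1}" using openO interior_maximal[of ?O "{s0..s1}"] by simp
  moreover have "0 \<in> ?O" "1 \<in> ?O" using u w by auto
  ultimately have "0 \<in> {s0<..<s1}" "1 \<in> {s0<..<s1}" by blast+
  then have "s0 < 0" "1 < s1" by auto
  moreover have "s0 \<notin> ?O" "s1 \<notin> ?O" using O by auto
  ultimately show ?thesis using that S by blast
qed

lemma proj_line_proj: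
  assumes "u \<noteq> 0" "w \<noteq> 0" "v \<noteq> 0"
  shows "proj v \<in> proj_line (proj u) (proj w) \<longleftrightarrow> v \<in> span {u, w}"
proof -
  have "span (span {u} \<union> span {w}) = span {u, w}"
  proof (rule subset_antisym)
    show "span (span {u} \<union> span {w}) \<subseteq> span {u, w}"
      by (intro span_minimal Un_least span_mono) auto
    show "span {u, w} \<subseteq> span (span {u} \<union> span {w})"
      by (intro span_mono) (auto intro: span_base)
  qed
  moreover have "span {v} \<subseteq> span {u, w} \<longleftrightarrow> v \<in> span {u, w}"
    using span_minimal[of "{v}" "span {u, w}"] span_base[of v "{v}"] by auto
  ultimately show ?thesis
    using assms by (simp add: proj_line_def line_of_proj del: span_Un)
qed

lemma hilbert_dist_chord:
  assumes u: "u \<in> cone" "a \<bullet> u = 1" and w: "w \<in> cone" "a \<bullet> w = 1" and "u \<noteq> w"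
    and s: "s0 < 0" "1 < s1" "{s. u + s *\<^sub>R (w - u) \<in> ccone} = {s0..s1}"
    "u + s0 *\<^sub>R (w - u) \<notin> cone" "u + s1 *\<^sub>R (w - u) \<notin> cone"
  shows "hilbert_dist \<Omega> (proj u) (proj w) = 1 / 2 * ln (s1 / (s1 - 1) * ((1 - s0) / (- s0)))"
proof -
  let ?d = "w - u"
  let ?l = "\<lambda>s. u + s *\<^sub>R ?d"
  let ?P = "?l s0" and ?Q = "?l s1"
  have d: "?d \<noteq> 0" using assms(5) by simp
  have al: "a \<bullet> ?l r = 1" for r using u w by (simp add: inner_add_right inner_diff_right)
  have nz: "?l r \<noteq> 0" for r using al[of r] by auto
  have coordl: "coord a (proj (?l r)) = ?l r" for r using al[of r] by (simp add: coord_proj)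
  have uw: "u = ?l 0" "w = ?l 1" by auto
  have cu: "coord a (proj u) = ?l 0" "coord a (proj w) = ?l 1" using coordl[of 0] coordl[of 1] by auto
  have nuw: "u \<noteq> 0" "w \<noteq> 0" using u w by auto
  have PQ: "?P \<in> ccone" "?Q \<in> ccone" using s by auto
  have bd: "proj ?P \<in> boundary \<Omega>" "proj ?Q \<in> boundary \<Omega>"
    using PQ s(4,5) nz proj_ccone proj_in_domain_iff by (auto simp: boundary_def)
  have seg: "coord a ` (proj_line (proj u) (proj w) \<inter> closure \<Omega>) = closed_segment ?P ?Q"
  proof -
    have "coord a ` (proj_line (proj u) (proj w) \<inter> closure \<Omega>) = ?l ` {s0..s1}"
    proof (intro equalityI subsetI)
      fix v assume "v \<in> coord a ` (proj_line (proj u) (proj w) \<inter> closure \<Omega>)"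
      then obtain z where z: "z \<in> proj_line (proj u) (proj w)" "z \<in> closure \<Omega>" "v = coord a z" by blast
      obtain v' where v': "v' \<in> ccone" "a \<bullet> v' = 1" "z = proj v'" "coord a z = v'"
        using z(2) by (rule closure_obtain)
      have "v' \<noteq> 0" using v'(2) by auto
      then have "v' \<in> span {u, w}" using z(1) v'(3) proj_line_proj[OF nuw] by blast
      then obtain p q where "v' = p *\<^sub>R u + q *\<^sub>R w"
        by (metis (no_types, lifting) add.commute diff_add_cancel span_breakdown_eq span_singleton rangeE)
      moreover from this have "p = 1 - q" using v'(2) u w by (simp add: inner_add_right)
      ultimately have "v' = ?l q" by (simp add: algebra_simps)
      moreover from this have "q \<in> {s0..s1}" using v'(1) s(3) by blast
      ultimately show "v \<in> ?l ` {s0..s1}" using z(3) v'(4) by blast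
    next
      fix v assume "v \<in> ?l ` {s0..s1}"
      then obtain r where r: "r \<in> {s0..s1}" "v = ?l r" by blast
      then have "v \<in> ccone" using s(3) by blast
      moreover have "v \<noteq> 0" unfolding r(2) by (rule nz)
      moreover have "v \<in> span {u, w}" unfolding r(2)
        by (intro span_add span_scale span_diff span_base) auto
      ultimately have "proj v \<in> proj_line (proj u) (proj w) \<inter> closure \<Omega>"
        using proj_line_proj[OF nuw] proj_ccone by blast
      then show "v \<in> coord a ` (proj_line (proj u) (proj w) \<inter> closure \<Omega>)"
        using coordl[of r] r(2) by (metis image_eqI)
    qed
    also have "\<dots> = closed_segment ?P ?Q"
      using s(1,2) by (simp add: closed_segment_affine_line closed_segment_eq_real_ivl)
    finally show ?thesis .
  qed
  have op: "?l r \<in> open_segment (?l p) (?l q)" if "p < r" "r < q" for p q r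
    using that d by (simp add: open_segment_affine_line open_segment_eq_real_ivl)
  have ends: "endpoints a \<Omega> (proj u) (proj w) (proj ?P, proj ?Q)"
    unfolding endpoints_def
    using bd seg op[of s0 0 1] op[of 0 1 s1] s(1,2) coordl[of s0] coordl[of s1] by (simp add: cu)
  \<comment> \<open>The closed segment determines its endpoints only as an unordered pair; the
    betweenness condition on \<open>u\<close> excludes the exchanged order.\<close>
  have "e = (proj ?P, proj ?Q)" if e: "endpoints a \<Omega> (proj u) (proj w) e" for e
  proof -
    obtain p q where pq: "e = (p, q)" by fastforce
    have "closed_segment ?P ?Q = closed_segment (coord a p) (coord a q)"
      and o: "coord a (proj u) \<in> open_segment (coord a p) (coord a (proj w))"
      and bpq: "p \<in> boundary \<Omega>" "q \<in> boundary \<Omega>"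
      using e seg unfolding endpoints_def pq by auto
    then have "{?P, ?Q} = {coord a p, coord a q}" by simp
    moreover have "coord a p \<noteq> ?Q"
    proof
      assume "coord a p = ?Q"
      then have "?l 0 \<in> open_segment ?Q (?l 1)" using o by (simp add: cu)
      also have "\<dots> = ?l ` {1<..<s1}"
        using s(2) by (simp add: open_segment_affine_line[OF d] open_segment_eq_real_ivl del: scaleR_one)
      finally obtain r where "1 < r" "?l 0 = ?l r" by auto
      then show False using d by simp
    qed
    ultimately have "coord a p = ?P" "coord a q = ?Q" by (auto simp: doubleton_eq_iff)
    moreover have "closure \<Omega> \<subseteq> affine_chart a" using chart unfolding convex_chart_def by blast
    then have "p \<in> affine_chart a" "q \<in> affine_chart a" using bpq unfolding boundary_def by auto
    ultimately show ?thesis using pq proj_coord by metis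
  qed
  then have the: "(THE e. endpoints a \<Omega> (proj u) (proj w) e) = (proj ?P, proj ?Q)"
    using ends by blast
  have dist: "dist (?l p) (?l q) = \<bar>p - q\<bar> * norm ?d" for p q
    by (simp add: dist_norm scaleR_diff_left[symmetric])
  have ne: "proj u \<noteq> proj w"
    using coordl[of 0] coordl[of 1] assms(5) by auto
  have "hilbert_dist \<Omega> (proj u) (proj w) = 1 / 2 *
      ln ((dist (?l 1) ?P * dist (?l 0) ?Q) / (dist (?l 0) ?P * dist (?l 1) ?Q))"
    unfolding hilbert_dist_def Let_def chart_choice[symmetric] the
    using ne by (simp only: cu coordl if_False prod.case)
  also have "(dist (?l 1) ?P * dist (?l 0) ?Q) / (dist (?l 0) ?P * dist (?l 1) ?Q)
      = ((1 - s0) * norm ?d * (s1 * norm ?d)) / ((- s0) * norm ?d * ((s1 - 1) * norm ?d))"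
    unfolding dist using s(1,2) by simp
  also have "\<dots> = s1 / (s1 - 1) * ((1 - s0) / (- s0))"
    using d s(1,2) by (simp add: divide_simps)
  finally show ?thesis .
qed

text \<open>Birkhoff's form of the Hilbert metric: it avoids charts and cross-ratios, and makes the
  invariance under linear automorphisms of the cone evident.\<close>

lemma hilbert_dist_normalized:
  assumes u: "u \<in> cone" "a \<bullet> u = 1" and w: "w \<in> cone" "a \<bullet> w = 1"
  obtains L M where "L \<ge> 1" "M \<ge> 1" "L *\<^sub>R w - u \<in> ccone" "M *\<^sub>R u - w \<in> ccone"
    "hilbert_dist \<Omega> (proj u) (proj w) = 1 / 2 * ln (L * M)"
    "\<And>l. l *\<^sub>R w - u \<in> ccone \<Longrightarrow> l \<ge> L" "\<And>m. m *\<^sub>R u - w \<in> ccone \<Longrightarrow> m \<ge> M"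
proof (cases "u = w")
  case True
  have zero: "(0::real ^ 'n) \<in> ccone" using ccone_scale[OF cone_ccone[OF u(1)], of 0] by simp
  have "l \<ge> 1" if "l *\<^sub>R u - u \<in> ccone" for l
    using ccone_nonneg[OF that] u(2) by (simp add: inner_diff_right)
  then show ?thesis using that[of 1 1] zero True by (simp add: hilbert_dist_def)
next
  case False
  obtain s0 s1 where s: "s0 < 0" "1 < s1" "{s. u + s *\<^sub>R (w - u) \<in> ccone} = {s0..s1}"
    "u + s0 *\<^sub>R (w - u) \<notin> cone" "u + s1 *\<^sub>R (w - u) \<notin> cone"
    using chord_interval[OF u w False] by blast
  let ?l = "\<lambda>s. u + s *\<^sub>R (w - u)"
  have T: "?l r \<in> ccone \<longleftrightarrow> s0 \<le> r \<and> r \<le> s1" for r using s(3) by (auto simp: set_eq_iff)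
  \<comment> \<open>These solve \<open>l / (l - 1) = s1\<close> and
    \<open>- 1 / (l - 1) = s0\<close>, the extreme cases of the two membership conditions found
    below.\<close>
  let ?L = "s1 / (s1 - 1)" and ?M = "(1 - s0) / (- s0)"
  have gt: "l > 1" if "l *\<^sub>R w - u \<in> ccone \<or> l *\<^sub>R u - w \<in> ccone" for l
  proof (rule ccontr)
    assume "\<not> l > 1"
    moreover have "l \<ge> 1" using that ccone_nonneg u(2) w(2) by (force simp: inner_diff_right)
    ultimately have "l = 1" by simp
    then have "w - u \<in> ccone \<or> u - w \<in> ccone" using that by simp
    then show False using ccone_pos u(2) w(2) False by (force simp: inner_diff_right)
  qed
  \<comment> \<open>Divided by \<open>l - 1\<close>, both vectors become points of the line through
    \<open>u\<close> and \<open>w\<close>, the first beyond \<open>w\<close> and the second before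
    \<open>u\<close>. Membership in the closed cone is thereby read off from the interval of
    parameters.\<close>
  have eq: "l *\<^sub>R w - u = (l - 1) *\<^sub>R ?l (l / (l - 1))"
    "l *\<^sub>R u - w = (l - 1) *\<^sub>R ?l (- 1 / (l - 1))" if "l > 1" for l :: real
  proof -
    have "(l - 1) *\<^sub>R ?l (l / (l - 1)) = (l - 1) *\<^sub>R u + l *\<^sub>R (w - u)"
      "(l - 1) *\<^sub>R ?l (- 1 / (l - 1)) = (l - 1) *\<^sub>R u + (- 1) *\<^sub>R (w - u)"
      using that by (simp_all add: scaleR_add_right scaleR_diff_right)
    then show "l *\<^sub>R w - u = (l - 1) *\<^sub>R ?l (l / (l - 1))"
      "l *\<^sub>R u - w = (l - 1) *\<^sub>R ?l (- 1 / (l - 1))" by (auto simp: algebra_simps)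
  qed
  have sc: "(l - 1) *\<^sub>R v \<in> ccone \<longleftrightarrow> v \<in> ccone" if "l > 1" for l v
    using ccone_scale[of v "l - 1"] ccone_scale[of "(l - 1) *\<^sub>R v" "inverse (l - 1)"] that by auto
  have L: "l *\<^sub>R w - u \<in> ccone \<longleftrightarrow> s0 \<le> l / (l - 1) \<and> l / (l - 1) \<le> s1" if "l > 1" for l
    using that by (simp only: eq sc T)
  have M: "l *\<^sub>R u - w \<in> ccone \<longleftrightarrow> s0 \<le> - 1 / (l - 1) \<and> - 1 / (l - 1) \<le> s1" if "l > 1" for l
    using that by (simp only: eq sc T)
  have LM1: "?L > 1" "?M > 1" using s by (auto simp: field_simps)
  show ?thesis
  proof (rule that[of ?L ?M])
    show "?L \<ge> 1" "?M \<ge> 1" using LM1 by auto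
    have "?L - 1 = 1 / (s1 - 1)" "?M - 1 = 1 / (- s0)" using s by (auto simp: field_simps)
    then have "?L / (?L - 1) = s1" "- 1 / (?M - 1) = s0" using s by auto
    then show "?L *\<^sub>R w - u \<in> ccone" "?M *\<^sub>R u - w \<in> ccone" using L[OF LM1(1)] M[OF LM1(2)] s by auto
    show "hilbert_dist \<Omega> (proj u) (proj w) = 1 / 2 * ln (?L * ?M)"
      by (rule hilbert_dist_chord[OF u w False s])
    show "l \<ge> ?L" if "l *\<^sub>R w - u \<in> ccone" for l
      using L[of l] gt[of l] that s by (auto simp: field_simps)
    show "l \<ge> ?M" if "l *\<^sub>R u - w \<in> ccone" for l
      using M[of l] gt[of l] that s by (auto simp: field_simps)
  qed
qed

text \<open>Rescaling \<open>x\<close> and \<open>y\<close> multiplies \<open>l\<close> and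
  \<open>m\<close> by inverse factors, so their product can be compared with that of the minimal
  pair for the normalised vectors.\<close>

lemma hilbert_dist_less_iff:
  assumes "x \<in> cone" "y \<in> cone"
  shows "hilbert_dist \<Omega> (proj x) (proj y) < \<delta> \<longleftrightarrow>
    (\<exists>l>0. \<exists>m>0. l *\<^sub>R y - x \<in> ccone \<and> m *\<^sub>R x - y \<in> ccone \<and> l * m < exp (2 * \<delta>))"
    (is "_ \<longleftrightarrow> ?R")
    and hilbert_dist_nonneg: "hilbert_dist \<Omega> (proj x) (proj y) \<ge> 0"
proof -
  let ?p = "a \<bullet> x" and ?q = "a \<bullet> y"
  define u where "u = x /\<^sub>R ?p"
  define w where "w = y /\<^sub>R ?q"
  have pos: "?p > 0" "?q > 0" using assms cone_pos by auto
  have u: "u \<in> cone" "a \<bullet> u = 1" "proj u = proj x" and w: "w \<in> cone" "a \<bullet> w = 1" "proj w = proj y"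
    using pos assms by (auto simp: u_def w_def cone_scale proj_scaleR)
  have xy: "x = ?p *\<^sub>R u" "y = ?q *\<^sub>R w" using pos by (auto simp: u_def w_def)
  obtain L M where LM: "L \<ge> 1" "M \<ge> 1" "L *\<^sub>R w - u \<in> ccone" "M *\<^sub>R u - w \<in> ccone"
    "hilbert_dist \<Omega> (proj x) (proj y) = 1 / 2 * ln (L * M)"
    "\<And>l. l *\<^sub>R w - u \<in> ccone \<Longrightarrow> l \<ge> L" "\<And>m. m *\<^sub>R u - w \<in> ccone \<Longrightarrow> m \<ge> M"
    using hilbert_dist_normalized[OF u(1,2) w(1,2)] unfolding u(3) w(3) by blast
  have LM1: "L * M \<ge> 1" using LM(1,2) mult_mono[of 1 L 1 M] by simp
  show "hilbert_dist \<Omega> (proj x) (proj y) \<ge> 0" using ln_ge_zero[OF LM1] LM(5) by simp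
  have "hilbert_dist \<Omega> (proj x) (proj y) < \<delta> \<longleftrightarrow> ln (L * M) < 2 * \<delta>" using LM(5) by auto
  also have "\<dots> \<longleftrightarrow> L * M < exp (2 * \<delta>)"
    using LM1 by (metis exp_less_cancel_iff exp_ln less_le_trans zero_less_one)
  also have "\<dots> \<longleftrightarrow> ?R"
  proof
    assume less: "L * M < exp (2 * \<delta>)"
    show ?R
    proof -
      have "L * ?p / ?q > 0" "M * ?q / ?p > 0" using pos LM by auto
      moreover
      have "(L * ?p / ?q) *\<^sub>R y - x = ?p *\<^sub>R (L *\<^sub>R w - u)"
        using pos by (simp add: u_def w_def scaleR_diff_right mult.commute divide_inverse)
      then have "(L * ?p / ?q) *\<^sub>R y - x \<in> ccone" using LM pos by (simp add: ccone_scale)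
      moreover
      have "(M * ?q / ?p) *\<^sub>R x - y = ?q *\<^sub>R (M *\<^sub>R u - w)"
        using pos by (simp add: u_def w_def scaleR_diff_right mult.commute divide_inverse)
      then have "(M * ?q / ?p) *\<^sub>R x - y \<in> ccone" using LM pos by (simp add: ccone_scale)
      moreover
      have "L * ?p / ?q * (M * ?q / ?p) < exp (2 * \<delta>)" using less pos by simp
      ultimately show ?R by blast
    qed
  next
    assume ?R
    then obtain l m where lm: "l > 0" "m > 0" "l *\<^sub>R y - x \<in> ccone" "m *\<^sub>R x - y \<in> ccone"
      "l * m < exp (2 * \<delta>)" by blast
    have "inverse ?p *\<^sub>R (l *\<^sub>R y - x) \<in> ccone" "inverse ?q *\<^sub>R (m *\<^sub>R x - y) \<in> ccone"
      using lm pos by (auto intro: ccone_scale)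
    moreover have "inverse ?p *\<^sub>R (l *\<^sub>R y - x) = (l * ?q / ?p) *\<^sub>R w - u"
      "inverse ?q *\<^sub>R (m *\<^sub>R x - y) = (m * ?p / ?q) *\<^sub>R u - w"
      using pos by (auto simp: u_def w_def scaleR_diff_right divide_inverse mult_ac)
    ultimately have "l * ?q / ?p \<ge> L" "m * ?p / ?q \<ge> M" using LM(6,7) by metis+
    then have "L * M \<le> (l * ?q / ?p) * (m * ?p / ?q)" using LM(1,2) by (intro mult_mono) auto
    also have "\<dots> = l * m" using pos by simp
    finally show "L * M < exp (2 * \<delta>)" using lm(5) by simp
  qed
  finally show "hilbert_dist \<Omega> (proj x) (proj y) < \<delta> \<longleftrightarrow> ?R" .
qed

end

section \<open>Limits under automorphisms\<close>

lemma finite_family_subseq: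
  fixes X :: "nat \<Rightarrow> nat \<Rightarrow> 'a::metric_space"
  assumes "compact S" "\<And>k j. j < n \<Longrightarrow> X k j \<in> S"
  shows "\<exists>l r. strict_mono (r :: nat \<Rightarrow> nat) \<and> (\<forall>j<n. l j \<in> S \<and> (\<lambda>k. X (r k) j) \<longlonglongrightarrow> l j)"
proof -
  have "\<exists>l r. strict_mono (r :: nat \<Rightarrow> nat) \<and> (\<forall>j<m. l j \<in> S \<and> (\<lambda>k. X (r k) j) \<longlonglongrightarrow> l j)"
    if "m \<le> n" for m
    using that
  proof (induction m)
    case 0
    show ?case by (auto intro: exI[of _ id] strict_mono_id)
  next
    case (Suc m)
    obtain l r where lr: "strict_mono (r :: nat \<Rightarrow> nat)"
      "\<forall>j<m. l j \<in> S \<and> (\<lambda>k. X (r k) j) \<longlonglongrightarrow> l j"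
      using Suc.IH[OF Suc_leD[OF Suc.prems]] by blast
    have "\<forall>k. X (r k) m \<in> S" using assms(2) Suc.prems by simp
    then obtain x s where x: "x \<in> S" "strict_mono (s :: nat \<Rightarrow> nat)" "((\<lambda>k. X (r k) m) \<circ> s) \<longlonglongrightarrow> x"
      by (rule seq_compactE[OF compact_imp_seq_compact[OF assms(1)]])
    have "(\<lambda>k. X (r (s k)) j) \<longlonglongrightarrow> l j" if "j < m" for j
      using LIMSEQ_subseq_LIMSEQ[OF _ x(2), of "\<lambda>k. X (r k) j"] lr(2) that by (simp add: o_def)
    then have "\<forall>j<Suc m. (l(m := x)) j \<in> S \<and> (\<lambda>k. X ((r \<circ> s) k) j) \<longlonglongrightarrow> (l(m := x)) j"
      using x lr(2) by (auto simp: less_Suc_eq o_def)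
    then show ?case using strict_mono_o[OF lr(1) x(2)] by blast
  qed
  then show ?thesis by blast
qed

text \<open>In the quotient topology, openness is tested on vectors, where the coordinate is
  \<open>v /\<^sub>R (a \<bullet> v)\<close>. It turns the compact set of quasi-homogeneity into a
  compact set of vectors.\<close>

lemma continuous_on_coord: "continuous_on (affine_chart a) (coord a)"
  unfolding continuous_on_topological
proof (intro ballI allI impI)
  fix x and B :: "(real ^ 'a) set" assume x: "x \<in> affine_chart a" and B: "open B" "coord a x \<in> B"
  let ?A = "{z \<in> affine_chart a. coord a z \<in> B}"
  have "{v. v \<noteq> 0 \<and> proj v \<in> ?A} = {v. a \<bullet> v \<noteq> 0} \<inter> (\<lambda>v. v /\<^sub>R (a \<bullet> v)) -` B"
    by (auto simp: proj_in_affine_chart coord_proj intro!: proj_in_affine_chart[THEN iffD2])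
  moreover have "open {v. a \<bullet> v \<noteq> 0}" by (intro open_Collect_neq continuous_intros)
  moreover have "continuous_on {v. a \<bullet> v \<noteq> 0} (\<lambda>v. v /\<^sub>R (a \<bullet> v))"
    by (intro continuous_intros) auto
  ultimately have "open ?A"
    using B(1) by (simp only: open_proj_space_def continuous_on_open_vimage) (simp add: Int_commute)
  then show "\<exists>A. open A \<and> x \<in> A \<and> (\<forall>y\<in>affine_chart a. y \<in> A \<longrightarrow> coord a y \<in> B)"
    using x B(2) by (intro exI[of _ ?A]) auto
qed

section \<open>Nearness of vectors, under linear maps and limits\<close>

context cone_over_domain
begin

text \<open>On the open cone this says that the Hilbert distance is less than \<delta>, where
  \<open>R = exp (2 * \<delta>)\<close>. It is unchanged when \<open>x\<close> and \<open>y\<close>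
  are multiplied by positive numbers.\<close>

definition near :: "real \<Rightarrow> real ^ 'n \<Rightarrow> real ^ 'n \<Rightarrow> bool" where
  "near R x y \<longleftrightarrow> (\<exists>l>0. \<exists>m>0. l *\<^sub>R y - x \<in> ccone \<and> m *\<^sub>R x - y \<in> ccone \<and> l * m < R)"

lemma near_mono: "near R x y \<Longrightarrow> R \<le> R' \<Longrightarrow> near R' x y"
  unfolding near_def by (meson less_le_trans)

lemma near_refl: "x \<in> cone \<Longrightarrow> R > 1 \<Longrightarrow> near R x x"
  using ccone_scale[OF cone_ccone, of x 0] unfolding near_def
  by (intro exI[of _ "1::real"] conjI) auto

text \<open>The strict bound on \<open>l * m\<close> leaves room to enlarge both factors by some
  \<open>e\<close>, and adding \<open>e *\<^sub>R y\<close> or \<open>e *\<^sub>R x\<close> leads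
  into the open cone. The open form shows that neighbourhoods are open.\<close>

lemma near_iff_open:
  assumes "x \<in> cone" "y \<in> cone"
  shows "near R x y \<longleftrightarrow> (\<exists>l>0. \<exists>m>0. l *\<^sub>R y - x \<in> cone \<and> m *\<^sub>R x - y \<in> cone \<and> l * m < R)"
proof
  assume "near R x y"
  then obtain l m where lm: "l > 0" "m > 0" "l *\<^sub>R y - x \<in> ccone" "m *\<^sub>R x - y \<in> ccone" "l * m < R"
    unfolding near_def by blast
  have "((\<lambda>e. (l + e) * (m + e)) \<longlongrightarrow> (l + 0) * (m + 0)) (at_right 0)" by (intro tendsto_intros)
  then have "eventually (\<lambda>e. (l + e) * (m + e) < R) (at_right 0)"
    using lm(5) order_tendstoD(2) by fastforce
  moreover have "eventually (\<lambda>e::real. e > 0) (at_right 0)" by (rule eventually_at_right_less)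
  ultimately have "eventually (\<lambda>e. (l + e) * (m + e) < R \<and> e > 0) (at_right 0)"
    by (rule eventually_conj)
  then obtain e where e: "(l + e) * (m + e) < R" "e > 0"
    using eventually_happens'[OF trivial_limit_at_right_real] by blast
  have "(l *\<^sub>R y - x) + e *\<^sub>R y \<in> cone" "(m *\<^sub>R x - y) + e *\<^sub>R x \<in> cone"
    using lm e assms by (auto intro: ccone_cone_add cone_scale)
  then have "(l + e) *\<^sub>R y - x \<in> cone" "(m + e) *\<^sub>R x - y \<in> cone" by (auto simp: algebra_simps)
  then show "\<exists>l>0. \<exists>m>0. l *\<^sub>R y - x \<in> cone \<and> m *\<^sub>R x - y \<in> cone \<and> l * m < R"
    using e lm by (intro exI[of _ "l + e"] conjI exI[of _ "m + e"]) auto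
qed (use cone_ccone near_def in blast)

lemma near_linear:
  assumes "linear f" "f ` cone \<subseteq> cone" "near R x y" shows "near R (f x) (f y)"
proof -
  have "f ` ccone \<subseteq> ccone"
    using closure_bounded_linear_image_subset[of f cone] closure_mono[OF assms(2)] assms(1)
    by (auto simp: linear_conv_bounded_linear)
  moreover obtain l m where lm: "l > 0" "m > 0" "l *\<^sub>R y - x \<in> ccone" "m *\<^sub>R x - y \<in> ccone" "l * m < R"
    using assms(3) unfolding near_def by blast
  ultimately have "f (l *\<^sub>R y - x) \<in> ccone" "f (m *\<^sub>R x - y) \<in> ccone" by blast+
  then have "l *\<^sub>R f y - f x \<in> ccone" "m *\<^sub>R f x - f y \<in> ccone"
    using assms(1) by (auto simp: linear_diff linear_scale)
  then show ?thesis using lm unfolding near_def by blast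
qed

text \<open>A large multiple of a vector of the open cone dominates any given vector, and strict
  domination persists near the limits. Thus sequences converging inside the cone stay at bounded
  distance.\<close>

lemma near_eventually:
  assumes X: "X \<longlonglongrightarrow> x" "x \<in> cone" and Y: "Y \<longlonglongrightarrow> y" "y \<in> cone"
  obtains R where "eventually (\<lambda>k. near R (X k) (Y k)) sequentially"
proof -
  have big: "\<exists>l>0. l *\<^sub>R u - v \<in> cone" if "u \<in> cone" for u v
  proof -
    have "((\<lambda>e. u - e *\<^sub>R v) \<longlongrightarrow> u - 0 *\<^sub>R v) (at_right (0::real))" by (intro tendsto_intros)
    then have "eventually (\<lambda>e. u - e *\<^sub>R v \<in> cone) (at_right (0::real))"
      using topological_tendstoD[OF _ open_cone, of "\<lambda>e. u - e *\<^sub>R v"] that by simp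
    moreover have "eventually (\<lambda>e::real. e > 0) (at_right 0)" by (rule eventually_at_right_less)
    ultimately have "eventually (\<lambda>e. u - e *\<^sub>R v \<in> cone \<and> e > 0) (at_right (0::real))"
      by (rule eventually_conj)
    then obtain e where e: "u - e *\<^sub>R v \<in> cone" "e > 0"
      using eventually_happens'[OF trivial_limit_at_right_real] by blast
    have "inverse e *\<^sub>R (u - e *\<^sub>R v) \<in> cone" using e by (intro cone_scale) auto
    then have "inverse e *\<^sub>R u - v \<in> cone" using e(2) by (simp add: scaleR_diff_right)
    then show ?thesis using e(2) by (intro exI[of _ "inverse e"]) auto
  qed
  obtain l where l: "l > 0" "l *\<^sub>R y - x \<in> cone" using big Y(2) by blast
  obtain m where m: "m > 0" "m *\<^sub>R x - y \<in> cone" using big X(2) by blast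
  have "(\<lambda>k. l *\<^sub>R Y k - X k) \<longlonglongrightarrow> l *\<^sub>R y - x" "(\<lambda>k. m *\<^sub>R X k - Y k) \<longlonglongrightarrow> m *\<^sub>R x - y"
    by (intro tendsto_intros X Y)+
  then have "eventually (\<lambda>k. l *\<^sub>R Y k - X k \<in> cone) sequentially"
    "eventually (\<lambda>k. m *\<^sub>R X k - Y k \<in> cone) sequentially"
    using l m open_cone topological_tendstoD by blast+
  then have "eventually (\<lambda>k. near (l * m + 1) (X k) (Y k)) sequentially"
  proof eventually_elim
    case (elim k)
    then show ?case using l(1) m(1) cone_ccone unfolding near_def
      by (intro exI[of _ l] conjI exI[of _ m]) auto
  qed
  then show ?thesis by (rule that)
qed

section \<open>Lifting automorphisms to the cone\<close>

text \<open>A priori \<open>f\<close> maps each vector of the cone into it or into its negative. A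
  change of sign would give a vector of the cone on whose image \<open>a\<close> vanishes, and the
  sign is right at \<open>u\<close>.\<close>

lemma linear_maps_cone:
  assumes f: "linear f" "\<And>v. v \<in> cone \<Longrightarrow> f v \<noteq> 0 \<and> proj (f v) \<in> \<Omega>" and u: "u \<in> cone" "f u \<in> cone"
  shows "f ` cone \<subseteq> cone"
proof (rule image_subsetI)
  fix v assume v: "v \<in> cone"
  have nz: "a \<bullet> f w \<noteq> 0" if "w \<in> cone" for w
    using f(2)[OF that] domain_chart closure_subset by blast
  have "\<not> a \<bullet> f v < 0"
  proof
    assume neg: "a \<bullet> f v < 0"
    have pos: "a \<bullet> f u > 0" using u(2) cone_pos by blast
    let ?w = "(- (a \<bullet> f v)) *\<^sub>R u + (a \<bullet> f u) *\<^sub>R v"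
    have "?w \<in> cone" using neg pos u v by (intro cone_add cone_scale) auto
    moreover have "a \<bullet> f ?w = 0"
      using f(1) by (simp add: linear_add linear_scale linear_neg linear_diff inner_add_right inner_diff_right)
    ultimately show False using nz by blast
  qed
  then show "f v \<in> cone" using nz[OF v] f(2)[OF v] by (simp add: cone_def)
qed

lemma cocompact_cone:
  assumes "quasi_homogeneous \<Omega>"
  obtains L where "compact L" "L \<subseteq> cone \<inter> {v. a \<bullet> v = 1}"
    "\<And>w. w \<in> cone \<Longrightarrow> \<exists>f g. linear f \<and> linear g \<and> (\<forall>v. f (g v) = v) \<and> (\<forall>v. g (f v) = v)
      \<and> f ` cone \<subseteq> cone \<and> g ` cone \<subseteq> cone \<and> f w \<in> L"
proof -
  obtain K where K: "compact K" "K \<subseteq> \<Omega>" "(\<Union>g \<in> Aut \<Omega>. g ` K) = \<Omega>"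
    using assms unfolding quasi_homogeneous_def by blast
  let ?L = "coord a ` K"
  have "K \<subseteq> affine_chart a"
    using K(2) chart closure_subset unfolding convex_chart_def by blast
  then have "compact ?L"
    using K(1) continuous_on_subset[OF continuous_on_coord] by (intro compact_continuous_image)
  moreover have "?L \<subseteq> cone \<inter> {v. a \<bullet> v = 1}" using K(2) coord_image_domain by blast
  moreover have "\<exists>f g. linear f \<and> linear g \<and> (\<forall>v. f (g v) = v) \<and> (\<forall>v. g (f v) = v)
      \<and> f ` cone \<subseteq> cone \<and> g ` cone \<subseteq> cone \<and> f w \<in> ?L" if w: "w \<in> cone" for w
  proof -
    have "proj w \<in> (\<Union>g \<in> Aut \<Omega>. g ` K)" using K(3) proj_cone[OF w] by simp
    then obtain h k where h: "h \<in> Aut \<Omega>" "k \<in> K" "proj w = h k" by blast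
    obtain A where A: "invertible A" "h = proj_map A" and hO: "h ` \<Omega> = \<Omega>"
      using h(1) unfolding Aut_def PGL_def by blast
    obtain B where B: "A ** B = mat 1" "B ** A = mat 1" using A(1) unfolding invertible_def by blast
    have AB: "A *v (B *v v) = v" "B *v (A *v v) = v" for v
      using B by (auto simp: matrix_vector_mul_assoc)
    have Anz: "A *v v \<noteq> 0" and Bnz: "B *v v \<noteq> 0" if "v \<noteq> 0" for v
      using AB that by (metis matrix_vector_mult_0_right)+
    have hproj: "h (proj v) = proj (A *v v)" if "v \<noteq> 0" for v
      using proj_map_proj Anz[OF that] A(2) by simp
    have cnz: "v \<noteq> 0" if "v \<in> cone" for v using cone_pos[OF that] by auto
    have k: "k \<in> \<Omega>" using h(2) K(2) by blast
    obtain u where u: "u \<in> cone" "a \<bullet> u = 1" "k = proj u" "coord a k = u"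
      using k by (rule domain_obtain)
    have "proj w = proj (A *v u)" using h(3) u(3) hproj cnz[OF u(1)] by simp
    then obtain c where c: "c \<noteq> 0" "A *v u = c *\<^sub>R w"
      using proj_eq_iff[of w "A *v u"] cnz[OF w] Anz[OF cnz[OF u(1)]] by blast
    \<comment> \<open>The automorphism carries a point of \<open>K\<close> to \<open>proj w\<close>,
      so its inverse is wanted. The factor \<open>c\<close>, of either sign, makes
      \<open>f w\<close> exactly the normalised lift \<open>u\<close>, which settles the sign of the
      lift.\<close>
    define f where "f v = c *\<^sub>R (B *v v)" for v
    define g where "g v = inverse c *\<^sub>R (A *v v)" for v
    have lin: "linear f" "linear g"
      unfolding f_def g_def by (auto intro!: linear_compose_scale_right matrix_vector_mul_linear)
    have inv: "f (g v) = v" "g (f v) = v" for v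
      using c(1) AB by (auto simp: f_def g_def matrix_vector_mult_scaleR)
    have "g u = w" using c by (simp add: g_def)
    then have fw: "f w = u" using inv by metis
    have "f ` cone \<subseteq> cone"
    proof (rule linear_maps_cone[OF lin(1) _ w])
      fix v assume v: "v \<in> cone"
      then obtain z where z: "z \<in> \<Omega>" "proj v = h z" using hO proj_cone by (metis imageE)
      obtain z' where z': "z' \<in> cone" "a \<bullet> z' = 1" "z = proj z'" "coord a z = z'"
        using z(1) by (rule domain_obtain)
      then have "proj v = proj (A *v z')" using z(2) hproj cnz by simp
      then obtain e where e: "e \<noteq> 0" "v = e *\<^sub>R (A *v z')"
        using proj_eq_iff[of "A *v z'" v] cnz[OF v] Anz[OF cnz[OF z'(1)]] by metis
      then have "f v = (c * e) *\<^sub>R z'" using AB by (simp add: f_def matrix_vector_mult_scaleR)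
      then show "f v \<noteq> 0 \<and> proj (f v) \<in> \<Omega>"
        using c(1) e(1) cnz[OF z'(1)] proj_cone[OF z'(1)] by (simp add: proj_scaleR)
    qed (simp add: fw u)
    moreover have "g ` cone \<subseteq> cone"
    proof (rule linear_maps_cone[OF lin(2) _ u(1)])
      fix v assume v: "v \<in> cone"
      have "proj (A *v v) \<in> \<Omega>" using hO proj_cone[OF v] hproj[OF cnz[OF v]] by (metis imageI)
      then show "g v \<noteq> 0 \<and> proj (g v) \<in> \<Omega>"
        using c(1) Anz[OF cnz[OF v]] by (simp add: g_def proj_scaleR)
    qed (simp add: \<open>g u = w\<close> w)
    moreover have "f w \<in> ?L" unfolding fw u(4)[symmetric] using h(2) by (rule imageI)
    ultimately show ?thesis using lin inv by blast
  qed
  ultimately show ?thesis by (rule that)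
qed

text \<open>Automorphisms move the points q k into a compact set; normalise the vertices on the hyperplane
  a v = 1 and pass to a subsequence.\<close>

lemma translate_limit:
  fixes n :: nat
  assumes qh: "quasi_homogeneous \<Omega>"
    and W: "\<And>k j. j \<le> n \<Longrightarrow> W k j \<in> ccone \<and> W k j \<noteq> 0"
    and J0: "J0 \<subseteq> {..n}" and q: "\<And>k. q k \<in> cone" "\<And>k. q k \<in> pos_hull (W k) J0"
    and FF: "\<And>J. J \<in> FF \<Longrightarrow> J \<subseteq> {..n}"
    and far: "\<And>J R. J \<in> FF \<Longrightarrow>
      eventually (\<lambda>k. \<forall>y \<in> pos_hull (W k) J \<inter> cone. \<not> near R (q k) y) sequentially"
  shows "\<exists>p w. p \<in> cone \<and> (\<forall>j\<le>n. w j \<in> ccone \<and> w j \<noteq> 0) \<and> p \<in> pos_hull w J0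
    \<and> (\<forall>J\<in>FF. pos_hull w J \<inter> cone = {})"
proof -
  obtain L where L: "compact L" "L \<subseteq> cone \<inter> {v. a \<bullet> v = 1}"
    "\<And>w. w \<in> cone \<Longrightarrow> \<exists>f g. linear f \<and> linear g \<and> (\<forall>v. f (g v) = v) \<and> (\<forall>v. g (f v) = v)
      \<and> f ` cone \<subseteq> cone \<and> g ` cone \<subseteq> cone \<and> f w \<in> L"
    using cocompact_cone[OF qh] by blast
  have "\<forall>k. \<exists>f g. linear f \<and> linear g \<and> (\<forall>v. f (g v) = v) \<and> (\<forall>v. g (f v) = v)
      \<and> f ` cone \<subseteq> cone \<and> g ` cone \<subseteq> cone \<and> f (q k) \<in> L" using L(3)[OF q(1)] by simp
  then obtain f g where fg: "\<And>k. linear (f k)" "\<And>k. linear (g k)" "\<And>k v. f k (g k v) = v"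
    "\<And>k v. g k (f k v) = v" "\<And>k. f k ` cone \<subseteq> cone" "\<And>k. g k ` cone \<subseteq> cone" "\<And>k. f k (q k) \<in> L"
    by metis
  have f_ccone: "f k v \<in> ccone" if "v \<in> ccone" for k v
    using closure_bounded_linear_image_subset[of "f k" cone] closure_mono[OF fg(5)[of k]] fg(1)[of k] that
    by (auto simp: linear_conv_bounded_linear)
  \<comment> \<open>The numbers \<open>c k j\<close> may tend to 0 or to infinity, so convergence is
    sought for the rescaled vertices \<open>V k j\<close>.\<close>
  define c where "c k j = a \<bullet> f k (W k j)" for k j
  define V where "V k j = f k (W k j) /\<^sub>R c k j" for k j
  have cpos: "c k j > 0" if "j \<le> n" for k j
  proof -
    have "f k (W k j) \<noteq> 0" using W[OF that] fg(1,4) by (metis linear_0)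
    then show ?thesis unfolding c_def using ccone_pos f_ccone W[OF that] by blast
  qed
  have fW: "f k (W k j) = c k j *\<^sub>R V k j" if "j \<le> n" for k j
    using cpos[OF that, of k] by (simp add: V_def)
  have gV: "g k (V k j) = inverse (c k j) *\<^sub>R W k j" if "j \<le> n" for k j
    using fg(2,4) by (simp add: V_def linear_scale)
  let ?S = "ccone \<inter> {v. a \<bullet> v = 1}"
  have VS: "V k j \<in> ?S" if "j \<le> n" for k j
  proof -
    have "V k j \<in> ccone" unfolding V_def
      using cpos[OF that, of k] W[OF that] f_ccone by (intro ccone_scale) auto
    moreover have "a \<bullet> V k j = 1" using cpos[OF that, of k] by (simp add: V_def c_def)
    ultimately show ?thesis by simp
  qed
  obtain B where B: "\<forall>v\<in>ccone. norm v \<le> B * (a \<bullet> v)" using ccone_norm_bound by blast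
  have "bounded ?S" by (rule boundedI[of _ B]) (use B in force)
  then have compS: "compact ?S"
    by (simp add: compact_eq_bounded_closed closed_Int closed_hyperplane)
  have "\<exists>t. f k (q k) = (\<Sum>j\<in>J0. t j *\<^sub>R V k j) \<and> (\<forall>j. 0 \<le> t j \<and> t j \<le> 1)" for k
  proof -
    obtain t where t: "q k = (\<Sum>j\<in>J0. t j *\<^sub>R W k j)" "\<forall>j\<in>J0. 0 \<le> t j"
      using q(2)[of k] unfolding pos_hull_def by blast
    define t' where "t' j = (if j \<in> J0 then t j * c k j else 0)" for j
    have pos: "0 \<le> t' j" for j using t(2) J0 less_imp_le[OF cpos[of j k]] by (auto simp: t'_def)
    have eq: "f k (q k) = (\<Sum>j\<in>J0. t' j *\<^sub>R V k j)"
      unfolding t(1) linear_sum[OF fg(1)] using fW J0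
      by (intro sum.cong) (auto simp: t'_def linear_scale[OF fg(1)])
    \<comment> \<open>As \<open>a\<close> equals 1 on \<open>f k (q k)\<close> and on every
      \<open>V k j\<close>, the new coefficients sum to 1. Being bounded, they can be passed to the
      limit along with the vertices.\<close>
    have "a \<bullet> f k (q k) = 1" using fg(7) L(2) by blast
    moreover have "a \<bullet> f k (q k) = (\<Sum>j\<in>J0. t' j)"
      unfolding eq inner_sum_right using VS J0 by (intro sum.cong) auto
    ultimately have sum1: "(\<Sum>j\<in>J0. t' j) = 1" by simp
    have fin: "finite J0" using finite_subset[OF J0] by simp
    have "t' j \<le> 1" for j
    proof (cases "j \<in> J0")
      case True
      then show ?thesis using member_le_sum[OF True, of t'] fin pos sum1 by simp
    qed (simp add: t'_def)
    then show ?thesis using eq pos by blast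
  qed
  then obtain t where t: "\<And>k. f k (q k) = (\<Sum>j\<in>J0. t k j *\<^sub>R V k j)"
    "\<And>k j. 0 \<le> t k j" "\<And>k j. t k j \<le> 1" by metis
  have comp: "compact ({0..1::real} \<times> ?S)" by (intro compact_Times compS) simp
  have mem: "(t k j, V k j) \<in> {0..1} \<times> ?S" if "j < Suc n" for k j
    using t(2,3) VS that by auto
  obtain l r where lr: "strict_mono (r :: nat \<Rightarrow> nat)"
    "\<forall>j<Suc n. l j \<in> {0..1} \<times> ?S \<and> (\<lambda>k. (t (r k) j, V (r k) j)) \<longlonglongrightarrow> l j"
    using finite_family_subseq[where X = "\<lambda>k j. (t k j, V k j)", OF comp mem] by blast
  define w where "w j = snd (l j)" for j
  define s where "s j = fst (l j)" for j
  have s: "0 \<le> s j" "(\<lambda>k. t (r k) j) \<longlonglongrightarrow> s j" if "j \<le> n" for j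
    using lr(2)[rule_format, of j] that tendsto_fst[of "\<lambda>k. (t (r k) j, V (r k) j)" "l j"] by (auto simp: s_def)
  have w: "w j \<in> ?S" "(\<lambda>k. V (r k) j) \<longlonglongrightarrow> w j" if "j \<le> n" for j
    using lr(2)[rule_format, of j] that tendsto_snd[of "\<lambda>k. (t (r k) j, V (r k) j)" "l j"] by (auto simp: w_def)
  have w': "w j \<in> ccone \<and> w j \<noteq> 0" if "j \<le> n" for j using w(1)[OF that] by auto
  define p where "p = (\<Sum>j\<in>J0. s j *\<^sub>R w j)"
  have lim: "(\<lambda>k. f (r k) (q (r k))) \<longlonglongrightarrow> p"
    unfolding t(1) p_def using J0 by (intro tendsto_sum tendsto_scaleR s(2) w(2)) auto
  have "p \<in> L" by (rule closed_sequentially[OF compact_imp_closed[OF L(1)] _ lim]) (simp add: fg(7))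
  then have p: "p \<in> cone" using L(2) by blast
  have "\<exists>j\<in>J0. 0 < s j"
  proof (rule ccontr)
    assume "\<not> ?thesis"
    then have "\<forall>j\<in>J0. s j = 0" using s(1) J0 by force
    then have "p = 0" by (simp add: p_def)
    then show False using cone_pos[OF p] by simp
  qed
  then have "p \<in> pos_hull w J0" unfolding p_def using subsetD[OF J0] by (intro pos_hullI) (simp add: s(1), blast)
  moreover have "pos_hull w J \<inter> cone = {}" if J: "J \<in> FF" for J
  proof (rule ccontr)
    assume "pos_hull w J \<inter> cone \<noteq> {}"
    then obtain y where y: "y \<in> pos_hull w J" "y \<in> cone" by blast
    obtain d where d: "y = (\<Sum>j\<in>J. d j *\<^sub>R w j)" "\<forall>j\<in>J. 0 \<le> d j" "\<exists>j\<in>J. 0 < d j"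
      using y(1) unfolding pos_hull_def by blast
    \<comment> \<open>Keeping the coefficients of \<open>y\<close> gives points of the translated
      facets that converge to \<open>y\<close>. They stay near the translates of \<open>q\<close>;
      pulled back by \<open>g\<close>, this contradicts \<open>far\<close>.\<close>
    define Y where "Y k = (\<Sum>j\<in>J. d j *\<^sub>R V (r k) j)" for k
    have Y: "Y \<longlonglongrightarrow> y" unfolding Y_def d(1) 
      using FF[OF J] by (intro tendsto_sum tendsto_scaleR tendsto_const w(2)) auto
    obtain R where "eventually (\<lambda>k. near R (f (r k) (q (r k))) (Y k)) sequentially"
      using near_eventually[OF lim p Y y(2)] by blast
    moreover have "eventually (\<lambda>k. Y k \<in> cone) sequentially"
      using topological_tendstoD[OF Y open_cone y(2)] .
    moreover have "eventually (\<lambda>k. \<forall>y \<in> pos_hull (W (r k)) J \<inter> cone. \<not> near R (q (r k)) y) sequentially"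
      using eventually_subseq[OF lr(1) far[OF J, of R]] .
    ultimately have "eventually (\<lambda>k. False) sequentially"
    proof eventually_elim
      case (elim k)
      have "near R (q (r k)) (g (r k) (Y k))"
        using near_linear[OF fg(2,6) elim(1), of "r k"] by (simp add: fg(4))
      moreover have "g (r k) (Y k) \<in> cone" using elim(2) fg(6) by blast
      moreover have "g (r k) (Y k) = (\<Sum>j\<in>J. (d j * inverse (c (r k) j)) *\<^sub>R W (r k) j)"
        unfolding Y_def linear_sum[OF fg(2)] using FF[OF J] gV
        by (intro sum.cong) (auto simp: linear_scale[OF fg(2)])
      moreover have "\<dots> \<in> pos_hull (W (r k)) J"
      proof (intro pos_hullI ballI)
        fix j assume "j \<in> J"
        then have "c (r k) j > 0" using FF[OF J] cpos by auto
        then show "0 \<le> d j * inverse (c (r k) j)" using d(2) \<open>j \<in> J\<close> by simp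
      next
        obtain j where j: "j \<in> J" "0 < d j" using d(3) by blast
        then have "c (r k) j > 0" using FF[OF J] cpos by auto
        then show "\<exists>j\<in>J. 0 < d j * inverse (c (r k) j)" using j by (intro bexI[of _ j]) auto
      qed
      ultimately show False using elim(3) by auto
    qed
    then show False by simp
  qed
  ultimately show ?thesis using p w' by blast
qed

end

section \<open>Slim simplices and centroids\<close>

lemma finite_maximizer:
  fixes f :: "'i \<Rightarrow> real"
  assumes "finite A" "A \<noteq> {}"
  shows "\<exists>m\<in>A. \<forall>j\<in>A. f j \<le> f m"
proof -
  have "Max (f ` A) \<in> f ` A" using assms by (intro Max_in) auto
  then obtain m where "m \<in> A" "Max (f ` A) = f m" by blast
  moreover have "f j \<le> Max (f ` A)" if "j \<in> A" for j using assms that by (intro Max_ge) auto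
  ultimately show ?thesis by auto
qed

lemma atMost_minus_nonempty: "n \<ge> 1 \<Longrightarrow> {..n} - {j :: nat} \<noteq> {}"
proof -
  assume "n \<ge> 1"
  then have "(if j = 0 then 1 else 0) \<in> {..n} - {j}" by auto
  then show ?thesis by blast
qed

section \<open>Dependent tuples and the exchange of vertices\<close>

text \<open>Dependence of an indexed family, not of its range: a repeated vertex counts as a
  dependence, as it must for simplices given by tuples.\<close>

definition lin_dep :: "('i \<Rightarrow> 'a::real_vector) \<Rightarrow> 'i set \<Rightarrow> bool" where
  "lin_dep w J \<longleftrightarrow> (\<exists>c. (\<exists>j\<in>J. c j \<noteq> 0) \<and> (\<Sum>j\<in>J. c j *\<^sub>R w j) = 0)"

lemma not_lin_depD:
  assumes "finite J" "\<not> lin_dep w J"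
  shows "inj_on w J" "independent (w ` J)"
proof -
  show inj: "inj_on w J"
  proof (rule inj_onI, rule ccontr)
    fix i j assume ij: "i \<in> J" "j \<in> J" "w i = w j" "i \<noteq> j"
    let ?c = "\<lambda>k. if k = i then 1 else if k = j then -1 else (0::real)"
    have "(\<Sum>k\<in>J. ?c k *\<^sub>R w k) = (\<Sum>k\<in>{i, j}. ?c k *\<^sub>R w k)"
      by (rule sum.mono_neutral_right) (use assms(1) ij in auto)
    also have "\<dots> = 0" using ij by simp
    finally have "lin_dep w J"
      unfolding lin_dep_def using ij(1) by (intro exI[of _ ?c] conjI bexI[of _ i]) auto
    then show False using assms(2) by simp
  qed
  show "independent (w ` J)"
  proof
    assume "dependent (w ` J)"
    then obtain u where u: "\<exists>v\<in>w ` J. u v \<noteq> 0" "(\<Sum>v\<in>w ` J. u v *\<^sub>R v) = 0"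
      using dependent_finite[of "w ` J"] assms(1) by auto
    then have "(\<Sum>j\<in>J. u (w j) *\<^sub>R w j) = 0" by (simp add: sum.reindex[OF inj])
    moreover have "\<exists>j\<in>J. u (w j) \<noteq> 0" using u(1) by auto
    ultimately have "lin_dep w J" unfolding lin_dep_def by (intro exI[of _ "\<lambda>j. u (w j)"] conjI)
    then show False using assms(2) by simp
  qed
qed

context cone_over_domain
begin

text \<open>Radon-type exchange: move along the dependency until the first coefficient vanishes.\<close>

lemma pos_hull_exchange:
  assumes fin: "finite J" and w: "\<forall>j\<in>J. w j \<in> ccone \<and> w j \<noteq> 0" and IJ: "I \<subseteq> J"
    and c: "\<exists>j\<in>J. c j \<noteq> 0" "(\<Sum>j\<in>J. c j *\<^sub>R w j) = 0" "\<forall>i\<in>J - I. c i \<ge> 0"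
    and x: "x \<in> pos_hull w I"
  shows "\<exists>j\<in>I. x \<in> pos_hull w (J - {j})"
proof -
  obtain t0 where t0: "x = (\<Sum>j\<in>I. t0 j *\<^sub>R w j)" "\<forall>j\<in>I. 0 \<le> t0 j"
    using x unfolding pos_hull_def by blast
  define t where "t j = (if j \<in> I then t0 j else 0)" for j
  have t: "x = (\<Sum>j\<in>J. t j *\<^sub>R w j)" "\<And>j. 0 \<le> t j"
    using t0 sum.mono_neutral_cong_left[OF fin IJ, of "\<lambda>j. t j *\<^sub>R w j" "\<lambda>j. t0 j *\<^sub>R w j"]
    by (auto simp: t_def)
  have apos: "a \<bullet> w j > 0" if "j \<in> J" for j using w that ccone_pos by blast
  let ?N = "{j \<in> J. c j < 0}"
  \<comment> \<open>Since \<open>a\<close> is positive on every \<open>w j\<close>, a nontrivial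
    dependency with nonnegative coefficients cannot sum to zero.\<close>
  have "?N \<noteq> {}"
  proof
    assume "?N = {}"
    then have nonneg: "0 \<le> c j * (a \<bullet> w j)" if "j \<in> J" for j
      using apos[OF that] that by (intro mult_nonneg_nonneg) (auto simp: not_less)
    have "(\<Sum>j\<in>J. c j * (a \<bullet> w j)) = a \<bullet> (\<Sum>j\<in>J. c j *\<^sub>R w j)" by (simp add: inner_sum_right)
    then have "(\<Sum>j\<in>J. c j * (a \<bullet> w j)) = 0" by (simp add: c(2))
    then have "\<forall>j\<in>J. c j * (a \<bullet> w j) = 0" using nonneg fin by (simp add: sum_nonneg_eq_0_iff)
    moreover obtain k where "k \<in> J" "c k \<noteq> 0" using c(1) by blast
    ultimately have "c k * (a \<bullet> w k) = 0" by blast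
    then show False using apos[OF \<open>k \<in> J\<close>] \<open>c k \<noteq> 0\<close> by simp
  qed
  then obtain i where i: "i \<in> ?N" "\<forall>j\<in>?N. - (t j / (- c j)) \<le> - (t i / (- c i))"
    using finite_maximizer[of ?N "\<lambda>j. - (t j / (- c j))"] fin by auto
  \<comment> \<open>The least of the ratios \<open>t j / (- c j)\<close>: subtracting any more would
    make a coefficient negative, and at \<open>i\<close> it becomes zero.\<close>
  define e where "e = t i / (- c i)"
  have e0: "e \<ge> 0" unfolding e_def using i(1) t(2)[of i] by (intro divide_nonneg_nonneg) auto
  have nonneg: "t j + e * c j \<ge> 0" if "j \<in> J" for j
  proof (cases "c j < 0")
    case True
    then have "e \<le> t j / (- c j)" using i(2)[rule_format, of j] that by (simp add: e_def)
    then have "e * (- c j) \<le> t j" using True by (simp only: pos_le_divide_eq neg_0_less_iff_less)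
    then show ?thesis by simp
  next
    case False
    then show ?thesis using t(2)[of j] e0 by simp
  qed
  have zero: "t i + e * c i = 0" using i(1) by (simp add: e_def)
  have "x = (\<Sum>j\<in>J. t j *\<^sub>R w j) + e *\<^sub>R (\<Sum>j\<in>J. c j *\<^sub>R w j)" by (simp add: t(1) c(2))
  also have "\<dots> = (\<Sum>j\<in>J. (t j + e * c j) *\<^sub>R w j)"
    by (simp add: scaleR_sum_right scaleR_add_left sum.distrib)
  also have "\<dots> = (\<Sum>j\<in>J - {i}. (t j + e * c j) *\<^sub>R w j)"
    using fin i(1) zero by (subst sum.remove[of J i]) auto
  finally have xe: "x = (\<Sum>j\<in>J - {i}. (t j + e * c j) *\<^sub>R w j)" .
  have "x \<noteq> 0" using pos_hull_ccone(3)[OF finite_subset[OF IJ fin] _ x] w IJ by blast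
  have "x \<in> pos_hull w (J - {i})"
    using \<open>x \<noteq> 0\<close> nonneg unfolding xe by (intro pos_hullI_nonzero) auto
  moreover have "i \<in> I" using i(1) c(3) by force
  ultimately show ?thesis by blast
qed

text \<open>The second claim is slimness at distance zero: a point on one facet also lies on
  another.\<close>

lemma lin_dep_facets:
  assumes fin: "finite J" and w: "\<forall>j\<in>J. w j \<in> ccone \<and> w j \<noteq> 0" and dep: "lin_dep w J"
  shows "x \<in> pos_hull w J \<Longrightarrow> \<exists>j\<in>J. x \<in> pos_hull w (J - {j})"
    and "x \<in> pos_hull w (J - {i}) \<Longrightarrow> \<exists>j\<in>J - {i}. x \<in> pos_hull w (J - {j})"
proof -
  obtain c where c: "\<exists>j\<in>J. c j \<noteq> 0" "(\<Sum>j\<in>J. c j *\<^sub>R w j) = 0" using dep unfolding lin_dep_def by blast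
  show "x \<in> pos_hull w J \<Longrightarrow> \<exists>j\<in>J. x \<in> pos_hull w (J - {j})"
    using pos_hull_exchange[OF fin w order_refl c] by simp
  \<comment> \<open>With the sign chosen so that the coefficient at \<open>i\<close> is nonnegative,
    the vertex that drops out is different from \<open>i\<close>.\<close>
  define c' where "c' j = (if c i \<ge> 0 then c j else - c j)" for j
  have c': "\<exists>j\<in>J. c' j \<noteq> 0" "(\<Sum>j\<in>J. c' j *\<^sub>R w j) = 0" "\<forall>k\<in>J - (J - {i}). c' k \<ge> 0"
    using c by (cases "c i \<ge> 0"; auto simp: c'_def sum_negf)+
  show "x \<in> pos_hull w (J - {i}) \<Longrightarrow> \<exists>j\<in>J - {i}. x \<in> pos_hull w (J - {j})"
    using pos_hull_exchange[OF fin w _ c', of x] by blast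
qed

lemma lin_dep_if_card:
  fixes w :: "nat \<Rightarrow> real ^ 'n"
  assumes "n \<ge> CARD('n)" shows "lin_dep w {..n}"
proof (rule ccontr)
  assume "\<not> lin_dep w {..n}"
  then have "inj_on w {..n}" "independent (w ` {..n})" using not_lin_depD[OF finite_atMost] by blast+
  then have "card {..n} \<le> DIM(real ^ 'n)" by (metis card_image independent_bound)
  then show False using assms by simp
qed

section \<open>Properly embedded simplices as limits\<close>

text \<open>Each vertex lies on a facet opposite to another one, hence in the boundary. A dependence
  would put \<open>p\<close> on a facet, which misses the open cone; so the simplex is
  nondegenerate.\<close>

lemma PES_if_pos_hull:
  assumes n: "n \<ge> 1" and w: "\<And>j. j \<le> n \<Longrightarrow> w j \<in> ccone \<and> w j \<noteq> 0"
    and p: "p \<in> cone" "p \<in> pos_hull w {..n}"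
    and bd: "\<And>j. j \<le> n \<Longrightarrow> pos_hull w ({..n} - {j}) \<inter> cone = {}"
  shows "PES \<Omega> n (\<lambda>j. proj (w j))"
proof -
  have w': "\<forall>j\<in>{..n}. w j \<in> ccone \<and> w j \<noteq> 0" using w by simp
  have CH: "CH \<Omega> ((\<lambda>j. proj (w j)) ` J) = proj ` pos_hull w J" if "J \<subseteq> {..n}" for J
    using that w finite_subset[OF that] by (intro CH_proj) auto
  have bdry: "proj ` pos_hull w ({..n} - {j}) \<subseteq> boundary \<Omega>" if "j \<le> n" for j
  proof
    fix z assume "z \<in> proj ` pos_hull w ({..n} - {j})"
    then obtain y where y: "z = proj y" "y \<in> pos_hull w ({..n} - {j})" by blast
    have "y \<in> ccone" "y \<noteq> 0" using pos_hull_ccone[OF _ _ y(2)] w by auto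
    then show "z \<in> boundary \<Omega>"
      using bd[OF that] y proj_ccone proj_in_domain_iff by (auto simp: boundary_def)
  qed
  have "proj (w i) \<in> boundary \<Omega>" if i: "i \<le> n" for i
  proof -
    obtain j where j: "j \<le> n" "j \<noteq> i" using that[of 0] that[of n] n by (cases "i = 0") auto
    then have "w i \<in> pos_hull w ({..n} - {j})" using i by (intro pos_hull_base) auto
    then show ?thesis using bdry[OF j(1)] by blast
  qed
  moreover have "\<not> lin_dep w {..n}"
    using lin_dep_facets(1)[OF finite_atMost w' _ p(2)] bd p(1) by blast
  then have "inj_on w {..n}" "independent (w ` {..n})" using not_lin_depD[OF finite_atMost] by blast+
  then have "dim (span (w ` {..n})) = n + 1"
    by (simp add: dim_span dim_eq_card_independent card_image)
  moreover have "span (\<Union>i\<le>n. line_of (proj (w i))) = span (w ` {..n})"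
  proof (rule subset_antisym)
    show "span (\<Union>i\<le>n. line_of (proj (w i))) \<subseteq> span (w ` {..n})"
    proof (intro span_minimal UN_least subspace_span)
      fix i assume "i \<in> {..n}"
      then show "line_of (proj (w i)) \<subseteq> span (w ` {..n})"
        using w[of i] by (simp add: line_of_proj span_mono)
    qed
    show "span (w ` {..n}) \<subseteq> span (\<Union>i\<le>n. line_of (proj (w i)))"
    proof (intro span_mono image_subsetI)
      fix i assume i: "i \<in> {..n}"
      then have "w i \<in> line_of (proj (w i))" using w[of i] by (simp add: line_of_proj span_base)
      then show "w i \<in> (\<Union>i\<le>n. line_of (proj (w i)))" using i by blast
    qed
  qed
  moreover have "proj_simplex \<Omega> n (\<lambda>j. proj (w j)) \<inter> \<Omega> \<noteq> {}"
    using p proj_cone unfolding proj_simplex_def CH[OF order_refl] by blast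
  ultimately show ?thesis
    using n bdry unfolding PES_def nondegenerate_def facet_def by (simp add: CH)
qed

text \<open>The vertex w i is extreme in the intersection with the span of the simplex: if y had too large a
  coefficient at some vertex, adding a multiple of p to a vector of the closed cone would produce a
  point of the open cone on a facet other than the one opposite to w i.\<close>

lemma far_from_opposite_facet:
  fixes n :: nat
  assumes i: "i \<le> n" and w: "\<And>j. j \<le> n \<Longrightarrow> w j \<in> ccone \<and> w j \<noteq> 0"
    and p: "p \<in> cone" "p \<in> pos_hull w ({..n} - {i})"
    and bd: "\<And>j. j \<le> n \<Longrightarrow> j \<noteq> i \<Longrightarrow> pos_hull w ({..n} - {j}) \<inter> cone = {}"
    and k: "k > 0" and y: "y \<in> pos_hull w ({..n} - {i})" and near: "near R (w i + (1 / k) *\<^sub>R p) y"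
  shows "k * (a \<bullet> w i) < R * (a \<bullet> p)"
proof -
  let ?J = "{..n} - {i}"
  let ?q = "w i + (1 / k) *\<^sub>R p"
  have apos: "a \<bullet> w j > 0" if "j \<le> n" for j using w[OF that] ccone_pos by blast
  obtain l where l: "p = (\<Sum>j\<in>?J. l j *\<^sub>R w j)" "\<forall>j\<in>?J. 0 \<le> l j"
    using p(2) unfolding pos_hull_def by blast
  obtain s where s: "y = (\<Sum>j\<in>?J. s j *\<^sub>R w j)" "\<forall>j\<in>?J. 0 \<le> s j"
    using y unfolding pos_hull_def by blast
  obtain L M where LM: "L > 0" "M > 0" "L *\<^sub>R y - ?q \<in> ccone" "M *\<^sub>R ?q - y \<in> ccone" "L * M < R"
    using near unfolding near_def by blast
  \<comment> \<open>A vanishing coefficient would place \<open>p\<close> on a further facet, and all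
    facets other than the one opposite to \<open>w i\<close> miss the open cone.\<close>
  have lpos: "l j > 0" if j: "j \<in> ?J" for j
  proof (rule ccontr)
    assume "\<not> l j > 0"
    then have lj: "l j = 0" using l(2) j by force
    have pe: "p = (\<Sum>k\<in>?J - {j}. l k *\<^sub>R w k)"
      unfolding l(1) sum.remove[OF finite_Diff[OF finite_atMost] j] by (simp add: lj)
    moreover have "p \<noteq> 0" using cone_pos[OF p(1)] by auto
    ultimately have "p \<in> pos_hull w (?J - {j})"
      using pos_hullI_nonzero[of "?J - {j}" l w] l(2) by simp
    then have "p \<in> pos_hull w ({..n} - {j})" using pos_hull_mono[of "{..n} - {j}" "?J - {j}" w] by auto
    then show False using bd[of j] j p(1) by auto
  qed
  have bound: "s j \<le> M / k * l j" if j: "j \<in> ?J" for j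
  proof (rule ccontr)
    assume "\<not> s j \<le> M / k * l j"
    then have gt: "s j / l j > M / k" using lpos[OF j] by (simp add: field_simps)
    obtain m where m: "m \<in> ?J" "\<forall>j\<in>?J. s j / l j \<le> s m / l m"
      using finite_maximizer[of ?J "\<lambda>j. s j / l j"] j by blast
    \<comment> \<open>At the maximal ratio, \<open>(M / k + e) *\<^sub>R p - y\<close> has
      nonnegative coefficients and the one at \<open>m\<close> is zero, so that adding
      \<open>M *\<^sub>R w i\<close> gives a point of the facet opposite to
      \<open>w m\<close>.\<close>
    define e where "e = s m / l m - M / k"
    have e: "e > 0" using gt m(2)[rule_format, OF j] by (simp add: e_def)
    define t where "t j = (if j = i then M else (M / k + e) * l j - s j)" for j
    have tJ: "t j \<ge> 0" if "j \<in> ?J" for j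
    proof -
      have "s j \<le> s m / l m * l j" using m(2)[rule_format, OF that] lpos[OF that] by (simp add: field_simps)
      then show ?thesis using that by (simp add: t_def e_def)
    qed
    have tm: "t m = 0" using m(1) lpos[OF m(1)] by (simp add: t_def e_def)
    have "(M *\<^sub>R ?q - y) + e *\<^sub>R p \<in> cone" using LM(4) p(1) e by (intro ccone_cone_add cone_scale)
    also have "(M *\<^sub>R ?q - y) + e *\<^sub>R p = M *\<^sub>R w i + ((M / k + e) *\<^sub>R p - y)"
      by (simp add: algebra_simps)
    also have "(M / k + e) *\<^sub>R p - y = (\<Sum>j\<in>?J. t j *\<^sub>R w j)"
      unfolding l(1) s(1) scaleR_sum_right sum_subtractf[symmetric]
      by (rule sum.cong) (auto simp: t_def scaleR_diff_left)
    also have "M *\<^sub>R w i + \<dots> = (\<Sum>j\<le>n. t j *\<^sub>R w j)"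
      using i by (subst sum.remove[of "{..n}" i]) (auto simp: t_def)
    also have "\<dots> = (\<Sum>j\<in>{..n} - {m}. t j *\<^sub>R w j)"
      using m(1) tm by (subst sum.remove[of "{..n}" m]) auto
    finally have "(\<Sum>j\<in>{..n} - {m}. t j *\<^sub>R w j) \<in> cone" .
    moreover have "(\<Sum>j\<in>{..n} - {m}. t j *\<^sub>R w j) \<in> pos_hull w ({..n} - {m})"
    proof (intro pos_hullI ballI)
      fix j assume "j \<in> {..n} - {m}"
      then show "0 \<le> t j" using tJ[of j] LM(2) by (cases "j = i") (auto simp: t_def)
    next
      show "\<exists>j\<in>{..n} - {m}. 0 < t j" using i m(1) LM(2) by (intro bexI[of _ i]) (auto simp: t_def)
    qed
    ultimately show False using bd[of m] m(1) by blast
  qed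
  have "a \<bullet> y = (\<Sum>j\<in>?J. s j * (a \<bullet> w j))" by (simp add: s(1) inner_sum_right)
  also have "\<dots> \<le> (\<Sum>j\<in>?J. M / k * l j * (a \<bullet> w j))"
    using bound apos by (intro sum_mono mult_right_mono) (auto simp: less_imp_le)
  also have "\<dots> = M / k * (a \<bullet> p)"
    unfolding l(1) inner_sum_right sum_distrib_left by (simp add: mult.assoc)
  finally have "a \<bullet> y \<le> M / k * (a \<bullet> p)" .
  \<comment> \<open>The two halves of nearness compete: \<open>y\<close> is at most of order
    \<open>M / k\<close>, yet \<open>L *\<^sub>R y\<close> must dominate \<open>w i\<close>.\<close>
  then have "L * (a \<bullet> y) \<le> L * (M / k * (a \<bullet> p))" using LM(1) by (intro mult_left_mono) auto
  moreover have "a \<bullet> ?q \<le> L * (a \<bullet> y)" using ccone_nonneg[OF LM(3)] by (simp add: inner_diff_right)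
  moreover have "a \<bullet> w i \<le> a \<bullet> ?q" using cone_pos[OF p(1)] k by (simp add: inner_add_right)
  ultimately have "a \<bullet> w i \<le> L * M * (a \<bullet> p) / k" by simp
  then have "k * (a \<bullet> w i) \<le> L * M * (a \<bullet> p)" using k by (simp add: field_simps)
  also have "\<dots> < R * (a \<bullet> p)" using LM(5) cone_pos[OF p(1)] by (rule mult_strict_right_mono)
  finally show ?thesis .
qed

lemma PES_if_far:
  fixes n :: nat
  assumes qh: "quasi_homogeneous \<Omega>" and n: "n \<ge> 1" and i: "i \<le> n"
    and W: "\<And>k j. j \<le> n \<Longrightarrow> W k j \<in> cone" and q: "\<And>k. q k \<in> pos_hull (W k) ({..n} - {i})"
    and far: "\<And>k j y. j \<le> n \<Longrightarrow> j \<noteq> i \<Longrightarrow> y \<in> pos_hull (W k) ({..n} - {j}) \<Longrightarrow> \<not> near (real k) (q k) y"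
  shows "\<exists>v. PES \<Omega> n v"
proof -
  let ?FF = "(\<lambda>j. {..n} - {j}) ` ({..n} - {i})"
  have W': "W k j \<in> ccone \<and> W k j \<noteq> 0" if "j \<le> n" for k j
    using W[OF that, of k] cone_pos cone_ccone by force
  have qc: "q k \<in> cone" for k using pos_hull_cone[OF _ _ q] W by simp
  have ev: "eventually (\<lambda>k. \<forall>y \<in> pos_hull (W k) J \<inter> cone. \<not> near R (q k) y) sequentially"
    if J: "J \<in> ?FF" for J R
  proof -
    obtain K where K: "R \<le> real K" using real_arch_simple by blast
    show ?thesis
      using eventually_ge_at_top[of K]
    proof eventually_elim
      case (elim k)
      then have "R \<le> real k" using K by simp
      then show ?case using far J near_mono by blast
    qed
  qed
  have "\<exists>p w. p \<in> cone \<and> (\<forall>j\<le>n. w j \<in> ccone \<and> w j \<noteq> 0) \<and> p \<in> pos_hull w ({..n} - {i})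
    \<and> (\<forall>J\<in>?FF. pos_hull w J \<inter> cone = {})"
    using W' qc q ev by (intro translate_limit[OF qh, where W = W and q = q]) auto
  then obtain p w where p: "p \<in> cone" "p \<in> pos_hull w ({..n} - {i})"
    and w: "\<And>j. j \<le> n \<Longrightarrow> w j \<in> ccone \<and> w j \<noteq> 0"
    and bd: "\<forall>J\<in>?FF. pos_hull w J \<inter> cone = {}" by blast
  have bd': "pos_hull w ({..n} - {j}) \<inter> cone = {}" if "j \<le> n" "j \<noteq> i" for j
    using bd that by simp
  \<comment> \<open>Projectively these points run from \<open>p\<close> towards the vertex
    \<open>w i\<close>. Facets other than the one opposite to it already miss the cone, so that only
    this one has to be escaped.\<close>
  define q' where "q' k = w i + (1 / real (Suc k)) *\<^sub>R p" for k
  let ?GG = "(\<lambda>j. {..n} - {j}) ` {..n}"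
  have q'1: "q' k \<in> cone" for k
    unfolding q'_def using w[OF i] p(1) by (intro ccone_cone_add cone_scale) auto
  have "p \<in> pos_hull w {..n}" using p(2) pos_hull_mono[of "{..n}" "{..n} - {i}" w] by blast
  then have q'2: "q' k \<in> pos_hull w {..n}" for k
    unfolding q'_def using i by (intro pos_hull_add pos_hull_base pos_hull_scale) auto
  have far': "eventually (\<lambda>k. \<forall>y \<in> pos_hull w J \<inter> cone. \<not> near R (q' k) y) sequentially"
    if J: "J \<in> ?GG" for J R
  proof -
    obtain j where j: "j \<le> n" "J = {..n} - {j}" using J by blast
    show ?thesis
    proof (cases "j = i")
      case True
      have api: "a \<bullet> w i > 0" using w[OF i] ccone_pos by blast
      obtain K where K: "R * (a \<bullet> p) / (a \<bullet> w i) \<le> real K" using real_arch_simple by blast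
      show ?thesis
        using eventually_ge_at_top[of K]
      proof eventually_elim
        case (elim k)
        show ?case
        proof (intro ballI notI)
          fix y assume y: "y \<in> pos_hull w J \<inter> cone" "near R (q' k) y"
          have "real (Suc k) * (a \<bullet> w i) < R * (a \<bullet> p)"
            using far_from_opposite_facet[OF i w p bd', of "real (Suc k)" y R] y j True
            unfolding q'_def by simp
          then have "real (Suc k) < R * (a \<bullet> p) / (a \<bullet> w i)" using api by (simp add: field_simps)
          then show False using K elim by linarith
        qed
      qed
    next
      case False
      then show ?thesis using bd' j by simp
    qed
  qed
  have "\<exists>p w'. p \<in> cone \<and> (\<forall>j\<le>n. w' j \<in> ccone \<and> w' j \<noteq> 0) \<and> p \<in> pos_hull w' {..n}
    \<and> (\<forall>J\<in>?GG. pos_hull w' J \<inter> cone = {})"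
    using w q'1 q'2 far' by (intro translate_limit[OF qh, where W = "\<lambda>_. w" and q = q']) auto
  then obtain p' w' where "p' \<in> cone" "p' \<in> pos_hull w' {..n}"
    and "\<And>j. j \<le> n \<Longrightarrow> w' j \<in> ccone \<and> w' j \<noteq> 0"
    and "\<forall>J\<in>?GG. pos_hull w' J \<inter> cone = {}" by blast
  then have "PES \<Omega> n (\<lambda>j. proj (w' j))" using n by (intro PES_if_pos_hull) auto
  then show ?thesis by blast
qed

section \<open>Uniform bounds in all dimensions\<close>

lemma near_uniform:
  fixes n :: nat
  assumes qh: "quasi_homogeneous \<Omega>" and n: "n \<ge> 1" and i: "i \<le> n" and "\<nexists>v. PES \<Omega> n v"
  shows "\<exists>R. \<forall>w. (\<forall>j\<le>n. w j \<in> cone) \<longrightarrow> (\<forall>x\<in>pos_hull w ({..n} - {i}).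
    \<exists>j\<in>{..n} - {i}. \<exists>y\<in>pos_hull w ({..n} - {j}). near R x y)"
proof (rule ccontr)
  assume neg: "\<not> ?thesis"
  have "\<forall>k::nat. \<exists>w x. (\<forall>j\<le>n. w j \<in> cone) \<and> x \<in> pos_hull w ({..n} - {i})
    \<and> (\<forall>j\<in>{..n} - {i}. \<forall>y\<in>pos_hull w ({..n} - {j}). \<not> near (real k) x y)"
    using neg by meson
  then obtain W q where "\<And>k::nat. (\<forall>j\<le>n. W k j \<in> cone) \<and> q k \<in> pos_hull (W k) ({..n} - {i})
    \<and> (\<forall>j\<in>{..n} - {i}. \<forall>y\<in>pos_hull (W k) ({..n} - {j}). \<not> near (real k) (q k) y)" by metis
  then have "\<exists>v. PES \<Omega> n v" by (intro PES_if_far[OF qh n i, of W q]) auto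
  then show False using assms(4) by simp
qed

lemma near_uniform_all:
  assumes qh: "quasi_homogeneous \<Omega>"
  shows "\<exists>R>1. \<forall>n i. n \<ge> 1 \<longrightarrow> (\<nexists>v. PES \<Omega> n v) \<longrightarrow> i \<le> n \<longrightarrow> (\<forall>w. (\<forall>j\<le>n. w j \<in> cone) \<longrightarrow>
    (\<forall>x\<in>pos_hull w ({..n} - {i}). \<exists>j\<in>{..n} - {i}. \<exists>y\<in>pos_hull w ({..n} - {j}). near R x y))"
proof -
  define good where "good R n i \<longleftrightarrow> (\<forall>w. (\<forall>j\<le>n. w j \<in> cone) \<longrightarrow> (\<forall>x\<in>pos_hull w ({..n} - {i}).
    \<exists>j\<in>{..n} - {i}. \<exists>y\<in>pos_hull w ({..n} - {j}). near R x y))" for R :: real and n i :: nat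
  have mono: "good R n i \<Longrightarrow> R \<le> R' \<Longrightarrow> good R' n i" for R R' n i
    unfolding good_def using near_mono by meson
  have "\<exists>R. n \<ge> 1 \<longrightarrow> (\<nexists>v. PES \<Omega> n v) \<longrightarrow> i \<le> n \<longrightarrow> good R n i" for n i
    using near_uniform[OF qh] unfolding good_def by blast
  then obtain f where f: "\<And>n i. n \<ge> 1 \<Longrightarrow> \<nexists>v. PES \<Omega> n v \<Longrightarrow> i \<le> n \<Longrightarrow> good (f n i) n i" by metis
  \<comment> \<open>The sum stands in for a maximum over the finitely many pairs with
    \<open>n < CARD('n)\<close>; larger tuples are dependent and any bound above 1 serves them. The
    summand 2 ensures \<open>R > 1\<close>.\<close>
  define R where "R = 2 + (\<Sum>(n, i)\<in>{..CARD('n)} \<times> {..CARD('n)}. \<bar>f n i\<bar>)"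
  have sum0: "(\<Sum>(n, i)\<in>{..CARD('n)} \<times> {..CARD('n)}. \<bar>f n i\<bar>) \<ge> 0" by (intro sum_nonneg) auto
  then have R1: "R > 1" by (simp add: R_def)
  have "good R n i" if n: "n \<ge> 1" "\<nexists>v. PES \<Omega> n v" "i \<le> n" for n i
  proof (cases "n < CARD('n)")
    case True
    have "(case (n, i) of (n, i) \<Rightarrow> \<bar>f n i\<bar>) \<le> (\<Sum>(n, i)\<in>{..CARD('n)} \<times> {..CARD('n)}. \<bar>f n i\<bar>)"
      using True n(3) by (intro member_le_sum) auto
    then have "f n i \<le> R" by (simp add: R_def)
    then show ?thesis using f[OF n] mono by blast
  next
    case False
    show ?thesis
      unfolding good_def
    proof (intro allI impI ballI)
      fix w x assume w: "\<forall>j\<le>n. w j \<in> cone" and x: "x \<in> pos_hull w ({..n} - {i})"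
      have "\<forall>j\<in>{..n}. w j \<in> ccone \<and> w j \<noteq> 0" using w cone_pos cone_ccone by force
      moreover have "lin_dep w {..n}" using False by (intro lin_dep_if_card) simp
      ultimately obtain j where "j \<in> {..n} - {i}" "x \<in> pos_hull w ({..n} - {j})"
        using lin_dep_facets(2)[OF finite_atMost _ _ x] by blast
      moreover have "x \<in> cone" using pos_hull_cone[OF _ _ x] w by simp
      ultimately show "\<exists>j\<in>{..n} - {i}. \<exists>y\<in>pos_hull w ({..n} - {j}). near R x y"
        using near_refl R1 by blast
    qed
  qed
  then show ?thesis using R1 unfolding good_def[symmetric] by blast
qed

text \<open>The dual form of the Knaster-Kuratowski-Mazurkiewicz lemma, where the set with index j contains the
  facet opposite to w j: a Brouwer fixed point of the map sending a point to the barycentre weighted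
  by its distances to the complements lies in all sets.\<close>

lemma near_all_facets:
  fixes m :: nat
  assumes m: "m \<ge> 1" and R: "R > 1" and w: "\<forall>j\<le>m. w j \<in> cone"
    and slim: "\<And>x. x \<in> pos_hull w ({..m} - {0}) \<Longrightarrow>
      \<exists>j\<in>{..m} - {0}. \<exists>y\<in>pos_hull w ({..m} - {j}). near R x y"
  obtains x where "x \<in> cone" "\<And>j. j \<le> m \<Longrightarrow> \<exists>y\<in>pos_hull w ({..m} - {j}). near R x y"
proof -
  let ?J = "{..m} - {0}"
  \<comment> \<open>A compact convex slice of the hull, which is itself invariant under scaling and
    thus not compact.\<close>
  let ?S = "convex hull (w ` ?J)"
  define U where "U j = {x \<in> cone. \<exists>y\<in>pos_hull w ({..m} - {j}). near R x y}" for j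
  have hull_cone: "y \<in> cone" if "y \<in> pos_hull w I" "I \<subseteq> {..m}" for y I
    using pos_hull_cone[OF finite_subset[OF that(2)] _ that(1)] w that(2) by auto
  have hullS: "?S \<subseteq> pos_hull w ?J"
    by (rule hull_minimal) (auto intro: pos_hull_base convex_pos_hull)
  have openU: "open (U j)" for j
  proof -
    have "U j = (\<Union>(y, l, r)\<in>{(y, l, r). y \<in> pos_hull w ({..m} - {j}) \<and> l > 0 \<and> r > 0 \<and> l * r < R}.
      cone \<inter> {x. l *\<^sub>R y - x \<in> cone} \<inter> {x. r *\<^sub>R x - y \<in> cone})"
      using near_iff_open hull_cone[OF _ Diff_subset] by (fastforce simp: U_def)
    moreover have "open ((\<lambda>x. l *\<^sub>R y - x) -` cone)" "open ((\<lambda>x. r *\<^sub>R x - y) -` cone)" for l r y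
      by (intro open_vimage open_cone continuous_intros)+
    then have "open {x. l *\<^sub>R y - x \<in> cone}" "open {x. r *\<^sub>R x - y \<in> cone}" for l r y
      by (auto simp: vimage_def)
    ultimately show ?thesis using open_cone by (auto intro!: open_UN open_Int)
  qed
  \<comment> \<open>The boundary condition of the covering argument: where the weight of
    \<open>w j\<close> vanishes, the point is on the facet with index \<open>j\<close>
    itself.\<close>
  have facetU: "pos_hull w (?J - {j}) \<subseteq> U j" for j
  proof
    fix x assume x: "x \<in> pos_hull w (?J - {j})"
    then have "x \<in> pos_hull w ({..m} - {j})" using pos_hull_mono[of "{..m} - {j}" "?J - {j}" w] by blast
    moreover have "x \<in> cone" using hull_cone[OF x] by blast
    ultimately show "x \<in> U j" using near_refl[OF _ R] by (auto simp: U_def)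
  qed
  define h where "h j x = infdist x (- U j)" for j x
  \<comment> \<open>The distance to an empty set is 0 by convention, which would falsify the next
    claim.\<close>
  have ne: "- U j \<noteq> {}" for j using cone_pos[of 0] by (auto simp: U_def)
  have h0: "h j x \<ge> 0" and hU: "h j x > 0 \<longleftrightarrow> x \<in> U j" for j x
  proof -
    show "h j x \<ge> 0" by (simp add: h_def infdist_nonneg)
    have "h j x = 0 \<longleftrightarrow> x \<in> - U j"
      unfolding h_def using in_closed_iff_infdist_zero[OF _ ne] openU by (simp add: closed_Compl)
    then show "h j x > 0 \<longleftrightarrow> x \<in> U j" using \<open>h j x \<ge> 0\<close> by auto
  qed
  define H where "H x = (\<Sum>j\<in>?J. h j x)" for x
  have Hpos: "H x > 0" if "x \<in> ?S" for x
  proof -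
    have x: "x \<in> pos_hull w ?J" using hullS that by blast
    obtain j where j: "j \<in> ?J" "\<exists>y\<in>pos_hull w ({..m} - {j}). near R x y" using slim[OF x] by blast
    then have "x \<in> U j" using hull_cone[OF x] by (simp add: U_def)
    with j(1) show ?thesis unfolding H_def using h0 hU by (intro sum_pos2[of ?J j]) auto
  qed
  define G where "G x = (\<Sum>j\<in>?J. (h j x / H x) *\<^sub>R w j)" for x
  have sum1: "(\<Sum>j\<in>?J. h j x / H x) = 1" if "x \<in> ?S" for x
    using Hpos[OF that] by (simp add: sum_divide_distrib[symmetric] H_def)
  have "G x \<in> ?S" if "x \<in> ?S" for x
    unfolding G_def using sum1[OF that] h0 less_imp_le[OF Hpos[OF that]]
    by (intro convex_sum convex_convex_hull) (auto intro: hull_inc)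
  moreover have "continuous_on ?S G"
    unfolding G_def H_def h_def
    by (intro continuous_intros ballI) (use Hpos in \<open>force simp: H_def h_def\<close>)
  moreover have "compact ?S" by (intro compact_convex_hull finite_imp_compact) simp
  moreover have "?S \<noteq> {}" using m by auto
  ultimately obtain x where x: "x \<in> ?S" "G x = x"
    using brouwer[of ?S G] convex_convex_hull by blast
  have xJ: "x \<in> pos_hull w ?J" using hullS x(1) by blast
  have xc: "x \<in> cone" using hull_cone[OF xJ] by blast
  \<comment> \<open>If \<open>x\<close> missed \<open>U j\<close>, the weight of \<open>w j\<close>
    in \<open>G x\<close> would be zero; the fixed point would then lie on a facet contained in
    \<open>U j\<close>.\<close>
  have "x \<in> U j" if j: "j \<in> ?J" for j
  proof (rule ccontr)
    assume "x \<notin> U j"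
    then have hj: "h j x = 0" using hU[of j x] h0[of j x] by linarith
    have "x = (\<Sum>k\<in>?J - {j}. (h k x / H x) *\<^sub>R w k)"
      using x(2) j hj unfolding G_def by (subst (asm) sum.remove[of _ j]) auto
    moreover have "x \<noteq> 0" using cone_pos[OF xc] by auto
    moreover have "0 \<le> h k x / H x" for k using h0 less_imp_le[OF Hpos[OF x(1)]] by simp
    ultimately have "x \<in> pos_hull w (?J - {j})"
      using pos_hullI_nonzero[of "?J - {j}" "\<lambda>k. h k x / H x" w] by simp
    then show False using facetU \<open>x \<notin> U j\<close> by blast
  qed
  then have "\<exists>y\<in>pos_hull w ({..m} - {j}). near R x y" if "j \<le> m" for j
    using that xJ near_refl[OF xc R] by (cases "j = 0") (auto simp: U_def)
  then show ?thesis using that xc by blast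
qed

end

section \<open>Return to the Hilbert metric\<close>

context hilbert_domain
begin

text \<open>An infimum of a nonempty set bounded below is less than \<delta> exactly when some
  member is, so no compactness of the hull enters.\<close>

lemma mem_hilbert_nbhd_iff:
  assumes J: "finite J" "J \<noteq> {}" "\<forall>j\<in>J. w j \<in> cone" and x: "x \<in> cone" and d: "\<delta> > 0"
  shows "proj x \<in> hilbert_nbhd \<Omega> \<delta> (CH \<Omega> ((\<lambda>j. proj (w j)) ` J)) \<longleftrightarrow>
    (\<exists>y\<in>pos_hull w J. near (exp (2 * \<delta>)) x y)"
proof -
  have cone: "y \<in> cone" if "y \<in> pos_hull w J" for y using pos_hull_cone[OF J(1,3) that] .
  have "CH \<Omega> ((\<lambda>j. proj (w j)) ` J) = proj ` pos_hull w J"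
    using J cone_pos cone_ccone by (intro CH_proj) force+
  moreover have "pos_hull w J \<noteq> {}" using pos_hull_base[OF J(1)] J(2) by blast
  moreover have "bdd_below (hilbert_dist \<Omega> (proj x) ` proj ` pos_hull w J)"
    by (rule bdd_belowI[of _ 0]) (use hilbert_dist_nonneg[OF x] cone in blast)
  ultimately have "proj x \<in> hilbert_nbhd \<Omega> \<delta> (CH \<Omega> ((\<lambda>j. proj (w j)) ` J)) \<longleftrightarrow>
      (\<exists>y\<in>pos_hull w J. hilbert_dist \<Omega> (proj x) (proj y) < \<delta>)"
    using d proj_cone[OF x] by (simp add: hilbert_nbhd_def cINF_less_iff)
  then show ?thesis using hilbert_dist_less_iff[OF x cone] by (auto simp: near_def)
qed

lemma slim_iff_near:
  assumes n: "n \<ge> 1" and w: "\<forall>j\<le>n. w j \<in> cone" and d: "\<delta> > 0"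
  shows "slim \<Omega> \<delta> n (\<lambda>j. proj (w j)) \<longleftrightarrow> (\<forall>i\<le>n. \<forall>x\<in>pos_hull w ({..n} - {i}).
    \<exists>j\<in>{..n} - {i}. \<exists>y\<in>pos_hull w ({..n} - {j}). near (exp (2 * \<delta>)) x y)"
proof -
  let ?H = "\<lambda>i. pos_hull w ({..n} - {i})" and ?F = "facet \<Omega> n (\<lambda>j. proj (w j))"
  have F: "?F i = proj ` ?H i" for i
    unfolding facet_def using w cone_pos cone_ccone by (intro CH_proj) force+
  have key: "proj x \<in> hilbert_nbhd \<Omega> \<delta> (?F j) \<longleftrightarrow> (\<exists>y\<in>?H j. near (exp (2 * \<delta>)) x y)"
    if x: "x \<in> ?H i" for x i j
    unfolding facet_def
  proof (rule mem_hilbert_nbhd_iff[OF _ atMost_minus_nonempty[OF n] _ _ d])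
    show "x \<in> cone" using pos_hull_cone[OF _ _ x] w by simp
  qed (use w in auto)
  have "slim \<Omega> \<delta> n (\<lambda>j. proj (w j)) \<longleftrightarrow>
      (\<forall>i\<le>n. \<forall>x\<in>?H i. \<exists>j\<in>{..n} - {i}. proj x \<in> hilbert_nbhd \<Omega> \<delta> (?F j))"
    unfolding slim_def F[THEN arg_cong[of _ _ "\<lambda>S. S \<subseteq> _"]] image_subset_iff UN_iff ..
  then show ?thesis using key by simp
qed

lemma domain_lift:
  assumes "\<forall>i\<le>n. x i \<in> \<Omega>"
  obtains w where "\<forall>i\<le>n. w i \<in> cone" "\<And>i. i \<le> n \<Longrightarrow> x i = proj (w i)"
proof -
  have "\<forall>i. \<exists>w. i \<le> n \<longrightarrow> w \<in> cone \<and> x i = proj w" using assms by (metis domain_obtain)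
  then obtain w where "\<forall>i. i \<le> n \<longrightarrow> w i \<in> cone \<and> x i = proj (w i)" by (rule choice[THEN exE])
  then show ?thesis using that[of w] by blast
qed

lemma slimness_constant_exists:
  assumes qh: "quasi_homogeneous \<Omega>"
  shows "\<exists>\<delta>0. slimness_constant \<Omega> \<delta>0"
proof -
  obtain R where R: "R > 1" "\<forall>n i. n \<ge> 1 \<longrightarrow> (\<nexists>v. PES \<Omega> n v) \<longrightarrow> i \<le> n \<longrightarrow> (\<forall>w. (\<forall>j\<le>n. w j \<in> cone) \<longrightarrow>
    (\<forall>x\<in>pos_hull w ({..n} - {i}). \<exists>j\<in>{..n} - {i}. \<exists>y\<in>pos_hull w ({..n} - {j}). near R x y))"
    using near_uniform_all[OF qh] by blast
  \<comment> \<open>Chosen so that \<open>exp (2 * ?d) = R\<close>; it is positive because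
    \<open>R > 1\<close>.\<close>
  let ?d = "ln R / 2"
  have d: "?d > 0" "exp (2 * ?d) = R" using R(1) by auto
  have "slim \<Omega> ?d n v" if n: "enat n \<ge> r_PES \<Omega> + 1" and v: "compact_simplex \<Omega> n v" for n v
  proof -
    have "\<nexists>v. PES \<Omega> n v"
    proof
      assume "\<exists>v. PES \<Omega> n v"
      then have "enat n \<le> r_PES \<Omega>" unfolding r_PES_def by (intro Sup_upper) blast
      then show False using n by (cases "r_PES \<Omega>") (auto simp: one_enat_def)
    qed
    have n1: "n \<ge> 1" and vO: "\<forall>i\<le>n. v i \<in> \<Omega>" using v unfolding compact_simplex_def by auto
    obtain w where w: "\<forall>i\<le>n. w i \<in> cone" "\<And>i. i \<le> n \<Longrightarrow> v i = proj (w i)"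
      using domain_lift[OF vO] by blast
    have "slim \<Omega> ?d n (\<lambda>j. proj (w j))"
      unfolding slim_iff_near[OF n1 w(1) d(1)] d(2) using R(2) n1 \<open>\<nexists>v. PES \<Omega> n v\<close> w(1) by blast
    moreover have "facet \<Omega> n v i = facet \<Omega> n (\<lambda>j. proj (w j)) i" for i
      unfolding facet_def by (rule arg_cong[of _ _ "CH \<Omega>"], rule image_cong) (auto simp: w(2))
    ultimately show ?thesis by (simp add: slim_def)
  qed
  then show ?thesis using d(1) unfolding slimness_constant_def by blast
qed

text \<open>Slimness is applied to the facet with index 0 alone; the point found lies near all
  facets with the bound for \<open>\<delta>0\<close>, which is then relaxed to \<delta>.\<close>

lemma centroid_nonempty:
  assumes slim: "slim \<Omega> \<delta>0 m x" and m: "m \<ge> 1" and x: "\<forall>i\<le>m. x i \<in> \<Omega>" and d0: "\<delta>0 > 0" and d: "\<delta>0 \<le> \<delta>"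
  shows "centroid \<Omega> \<delta> m x \<noteq> {}"
proof -
  obtain w where w: "\<forall>i\<le>m. w i \<in> cone" "\<And>i. i \<le> m \<Longrightarrow> x i = proj (w i)"
    using domain_lift[OF x] by blast
  have img: "x ` ({..m} - {i}) = (\<lambda>j. proj (w j)) ` ({..m} - {i})" for i
    by (rule image_cong) (auto simp: w(2))
  have "slim \<Omega> \<delta>0 m (\<lambda>j. proj (w j))"
    using slim unfolding slim_def facet_def img .
  then have s: "\<exists>j\<in>{..m} - {0}. \<exists>y\<in>pos_hull w ({..m} - {j}). near (exp (2 * \<delta>0)) z y"
    if "z \<in> pos_hull w ({..m} - {0})" for z
    using that unfolding slim_iff_near[OF m w(1) d0] by blast
  obtain z where z: "z \<in> cone" "\<And>j. j \<le> m \<Longrightarrow> \<exists>y\<in>pos_hull w ({..m} - {j}). near (exp (2 * \<delta>0)) z y"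
    using near_all_facets[OF m _ w(1) s] d0 by auto
  note ne = atMost_minus_nonempty[OF m]
  have "proj z \<in> hilbert_nbhd \<Omega> \<delta> (CH \<Omega> (x ` ({..m} - {i})))" if "i \<le> m" for i
  proof -
    have "exp (2 * \<delta>0) \<le> exp (2 * \<delta>)" using d by simp
    then have "\<exists>y\<in>pos_hull w ({..m} - {i}). near (exp (2 * \<delta>)) z y"
      using z(2)[OF that] near_mono by blast
    then show ?thesis
      unfolding img using mem_hilbert_nbhd_iff[OF _ ne _ z(1), of i w \<delta>] w(1) d0 d by auto
  qed
  then show ?thesis unfolding centroid_def by blast
qed

end

theorem theorem1p7:
  fixes \<Omega> :: "('n::finite) proj_space set" and m :: nat
  assumes "properly_convex_domain \<Omega>"
    and "quasi_homogeneous \<Omega>"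
    and "enat m \<ge> r_PES \<Omega> + 1"
  shows "(\<exists>\<delta>0'>0. \<forall>x. (\<forall>i\<le>m. x i \<in> \<Omega>) \<longrightarrow> (\<forall>\<delta>\<ge>\<delta>0'. centroid \<Omega> (\<delta> / 2) m x \<noteq> {}))
    \<and> (\<exists>\<delta>0. slimness_constant \<Omega> \<delta>0)
    \<and> (\<forall>\<delta>0. slimness_constant \<Omega> \<delta>0 \<longrightarrow>
         (\<forall>x. (\<forall>i\<le>m. x i \<in> \<Omega>) \<longrightarrow> (\<forall>\<delta>\<ge>2 * \<delta>0. centroid \<Omega> (\<delta> / 2) m x \<noteq> {})))"
proof -
  define a where "a = (SOME b. convex_chart \<Omega> b)"
  have "\<exists>b. convex_chart \<Omega> b" "open \<Omega>" "\<Omega> \<noteq> {}"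
    using assms(1) unfolding properly_convex_domain_def by auto
  then interpret hilbert_domain \<Omega> a
    by unfold_locales (auto simp: a_def someI_ex)
  have m: "m \<ge> 1"
    using order.trans[OF _ assms(3), of 1] by (simp add: one_enat_def)
  have c: "centroid \<Omega> (\<delta> / 2) m x \<noteq> {}"
    if "slimness_constant \<Omega> \<delta>0" "\<forall>i\<le>m. x i \<in> \<Omega>" "\<delta> \<ge> 2 * \<delta>0" for \<delta>0 \<delta> x
  proof (rule centroid_nonempty[OF _ m that(2)])
    show "slim \<Omega> \<delta>0 m x" "\<delta>0 > 0" "\<delta>0 \<le> \<delta> / 2"
      using that assms(3) m unfolding slimness_constant_def compact_simplex_def by auto
  qed
  obtain \<delta>0 where "slimness_constant \<Omega> \<delta>0" using slimness_constant_exists[OF assms(2)] by blast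
  moreover from this have "2 * \<delta>0 > 0" unfolding slimness_constant_def by simp
  ultimately show ?thesis using c by blast
qed

end
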